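(* Let $\varphi_0$ be a Banach-Minkowski norm on $\mathbb R^2$ that is not Euclidean and, moreover, such that there is no nonempty open subset of $\mathbb R^2$ on which $\varphi_0$ equals the restriction of a Euclidean norm. For $\theta\in\mathbb R$ let $R^\theta(\xi,\eta)=(\cos\theta\cdot\xi-\sin\theta\cdot\eta,\ \sin\theta\cdot\xi+\cos\theta\cdot\eta)$ be the rotation of $\mathbb R^2$ by angle $\theta$, and define a Finsler metric $\varphi$ on $\mathbb R^2$ by $$\varphi(x,y,\xi,\eta)=\varphi_0(R^y(\xi,\eta)),$$ where $(x,y)$ are the coordinates of a point of $\mathbb R^2$ and $(\xi,\eta)$ are the coordinates of a tangent vector in $T_{(x,y)}\mathbb R^2\cong\mathbb R^2$. Then no nonempty open subset of $(\mathbb R^2,\varphi)$ admits a smooth isometric embedding to a $3$-dimensional Banach-Minkowski space.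
   Context: "Smooth" means $C^\infty$. A norm on a real vector space $V$ is a subadditive, positively homogeneous function $\Phi\colon V\to[0,\infty)$, positive on $V\setminus\{0\}$, not required to be symmetric; it is Euclidean if it is associated with an inner product. A Banach-Minkowski norm is a norm that is smooth on $V\setminus\{0\}$ and such that $\Phi^2$ is quadratically strictly convex (second differential positive definite at every $v\neq0$). A Banach-Minkowski space is a finite-dimensional vector space with a Banach-Minkowski norm. A Finsler metric on a smooth manifold $M$ is a continuous $\varphi\colon TM\to[0,\infty)$, smooth on $TM$ minus the zero section, whose restriction to each tangent space is a Banach-Minkowski norm. A smooth embedding $f\colon U\to(V,\Phi)$ of a Finsler manifold $(U,\varphi)$ is isometric if $\Phi(d_xf(v))=\varphi(v)$ for all $x\in U$, $v\in T_xU$. *)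

theory Defs
  imports "HOL-Analysis.Analysis"
begin

text \<open>
  Class \<open>C\<^sup>n\<close> on an open subset of a Euclidean space: \<open>f\<close> is differentiable, and each directional
  derivative \<open>\<lambda>x. f'(x) v\<close> is of class \<open>C\<^sup>n\<^sup>-\<^sup>1\<close>. In finite dimension this agrees with
  continuity of all partial derivatives of order at most \<open>n\<close>. Derivatives are two-sided, so
  the notion is meant for open \<open>S\<close> only.
\<close>

primrec Cn_on :: "nat \<Rightarrow> 'a::euclidean_space set \<Rightarrow> ('a \<Rightarrow> 'b::real_normed_vector) \<Rightarrow> bool" where
  "Cn_on 0 S f \<longleftrightarrow> continuous_on S f"
| "Cn_on (Suc n) S f \<longleftrightarrow>
     (\<forall>x\<in>S. f differentiable (at x)) \<and> (\<forall>v. Cn_on n S (\<lambda>x. frechet_derivative f (at x) v))"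

definition smooth_on :: "'a::euclidean_space set \<Rightarrow> ('a \<Rightarrow> 'b::real_normed_vector) \<Rightarrow> bool" where
  "smooth_on S f \<longleftrightarrow> (\<forall>n. Cn_on n S f)"

text \<open>Norms need not be symmetric: homogeneity is required for nonnegative factors only.\<close>

definition asym_norm :: "('v::real_vector \<Rightarrow> real) \<Rightarrow> bool" where
  "asym_norm \<Phi> \<longleftrightarrow>
     (\<forall>v. \<Phi> v \<ge> 0) \<and>
     (\<forall>v w. \<Phi> (v + w) \<le> \<Phi> v + \<Phi> w) \<and>
     (\<forall>t v. t \<ge> 0 \<longrightarrow> \<Phi> (t *\<^sub>R v) = t * \<Phi> v) \<and>
     (\<forall>v. v \<noteq> 0 \<longrightarrow> \<Phi> v > 0)"

definition inner_product :: "('v::real_vector \<Rightarrow> 'v \<Rightarrow> real) \<Rightarrow> bool" where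
  "inner_product B \<longleftrightarrow>
     bilinear B \<and> (\<forall>v w. B v w = B w v) \<and> (\<forall>v. v \<noteq> 0 \<longrightarrow> B v v > 0)"

text \<open>Any inner product is allowed here, not only the one of the ambient type class.\<close>

definition euclidean_norm :: "('v::real_vector \<Rightarrow> real) \<Rightarrow> bool" where
  "euclidean_norm \<Phi> \<longleftrightarrow> (\<exists>B. inner_product B \<and> (\<forall>v. \<Phi> v = sqrt (B v v)))"

definition second_differential ::
  "('v::real_normed_vector \<Rightarrow> real) \<Rightarrow> 'v \<Rightarrow> 'v \<Rightarrow> 'v \<Rightarrow> real" where
  "second_differential F v w u =
     frechet_derivative (\<lambda>z. frechet_derivative F (at z) w) (at v) u"

definition quadratically_strictly_convex :: "('v::real_normed_vector \<Rightarrow> real) \<Rightarrow> bool" where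
  "quadratically_strictly_convex F \<longleftrightarrow>
     (\<forall>v w. v \<noteq> 0 \<longrightarrow> w \<noteq> 0 \<longrightarrow> second_differential F v w w > 0)"

text \<open>
  The class \<open>euclidean_space\<close> supplies finite dimension and the standard topology and smooth
  structure; its own norm plays no role.
\<close>

definition banach_minkowski_norm :: "('v::euclidean_space \<Rightarrow> real) \<Rightarrow> bool" where
  "banach_minkowski_norm \<Phi> \<longleftrightarrow>
     asym_norm \<Phi> \<and> smooth_on (UNIV - {0}) \<Phi> \<and>
     quadratically_strictly_convex (\<lambda>v. (\<Phi> v)\<^sup>2)"

text \<open>
  For an open subset \<open>U\<close> of \<open>'a\<close> the tangent bundle is \<open>U \<times> UNIV\<close>; the value of the metric on
  the tangent vector \<open>v\<close> at \<open>x\<close> is \<open>\<phi> x v\<close>.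
\<close>

definition finsler_metric_on ::
  "'a::euclidean_space set \<Rightarrow> ('a \<Rightarrow> 'a \<Rightarrow> real) \<Rightarrow> bool" where
  "finsler_metric_on U \<phi> \<longleftrightarrow>
     continuous_on (U \<times> UNIV) (\<lambda>(x, v). \<phi> x v) \<and>
     smooth_on (U \<times> (UNIV - {0})) (\<lambda>(x, v). \<phi> x v) \<and>
     (\<forall>x\<in>U. banach_minkowski_norm (\<phi> x))"

definition smooth_embedding_on ::
  "'a::euclidean_space set \<Rightarrow> ('a \<Rightarrow> 'v::euclidean_space) \<Rightarrow> bool" where
  "smooth_embedding_on U f \<longleftrightarrow>
     smooth_on U f \<and>
     (\<forall>x\<in>U. inj (frechet_derivative f (at x))) \<and>
     embedding_map (top_of_set U) euclidean f"

definition isometric_embedding_on ::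
  "'a::euclidean_space set \<Rightarrow> ('a \<Rightarrow> 'a \<Rightarrow> real) \<Rightarrow> ('v::euclidean_space \<Rightarrow> real)
     \<Rightarrow> ('a \<Rightarrow> 'v) \<Rightarrow> bool" where
  "isometric_embedding_on U \<phi> \<Phi> f \<longleftrightarrow>
     smooth_embedding_on U f \<and>
     (\<forall>x\<in>U. \<forall>v. \<Phi> (frechet_derivative f (at x) v) = \<phi> x v)"

definition rotation :: "real \<Rightarrow> real \<times> real \<Rightarrow> real \<times> real" where
  "rotation \<theta> = (\<lambda>(\<xi>, \<eta>). (cos \<theta> * \<xi> - sin \<theta> * \<eta>, sin \<theta> * \<xi> + cos \<theta> * \<eta>))"

definition rotated_metric ::
  "(real \<times> real \<Rightarrow> real) \<Rightarrow> real \<times> real \<Rightarrow> real \<times> real \<Rightarrow> real" where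
  "rotated_metric \<phi>\<^sub>0 = (\<lambda>(x, y) v. \<phi>\<^sub>0 (rotation y v))"

end

theory Submission
  imports Defs
begin

text \<open>
  Write \<open>F = \<phi>\<^sub>0\<^sup>2\<close>, \<open>G = \<Phi>\<^sup>2\<close> and \<open>E p = d\<^sub>p f \<circ> R\<^sup>-\<^sup>y\<close>, so that every \<open>E p\<close> is a linear isometry from
  \<open>(\<real>\<^sup>2, \<phi>\<^sub>0)\<close> onto a tangent plane. Differentiating \<open>G (E p u) = F u\<close> in \<open>p\<close> shows that each \<open>\<partial>\<^sub>iE u\<close>
  is tangent to the level set of \<open>G\<close> at \<open>E p u\<close>. Since \<open>\<phi>\<^sub>0\<close> is not Euclidean, a linear or quadratic
  vector field on the plane that is tangent to the level sets of \<open>F\<close> vanishes.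

  Let \<open>\<beta>\<^sub>i u\<close> be the normal component of \<open>\<partial>\<^sub>iE u\<close>. If \<open>\<beta>\<^sub>1, \<beta>\<^sub>2\<close> were independent at a point, the quadratic
  field \<open>\<beta>\<^sub>1(u) \<partial>\<^sub>2E u - \<beta>\<^sub>2(u) \<partial>\<^sub>1E u\<close> would give \<open>\<partial>\<^sub>iE u = \<beta>\<^sub>i(u) m\<close> for a fixed transversal vector \<open>m\<close>,
  and one more differentiation contradicts \<open>D\<^sup>2G(m, m) > 0\<close>. Hence they are dependent everywhere, and
  then so are \<open>\<partial>\<^sub>1E\<close> and \<open>\<partial>\<^sub>2E\<close>: the surface is developable. Symmetry of \<open>d\<^sup>2f\<close> ties the rulings to the
  rotation \<open>R\<^sup>y\<close> and forces \<open>\<partial>\<^sub>1E = 0\<close>; what remains says that \<open>\<phi>\<^sub>0\<close> is rotationally invariant to first order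
  along the directions \<open>(cos y, sin y)\<close>, so \<open>\<phi>\<^sub>0\<close> is a multiple of the standard norm on a sector.
\<close>

subsection \<open>Calculus of finitely often differentiable maps\<close>

lemma Cn_on_cong:
  assumes "open S" "Cn_on n S f" "\<And>x. x \<in> S \<Longrightarrow> f x = g x"
  shows "Cn_on n S g"
  using assms(2,3)
proof (induction n arbitrary: f g)
  case 0
  then show ?case by (simp cong: continuous_on_cong)
next
  case (Suc n)
  have d: "(g has_derivative frechet_derivative f (at x)) (at x)" if "x \<in> S" for x
    using has_derivative_transform_within_open[OF _ assms(1) that] Suc.prems that
    by (metis Cn_on.simps(2) frechet_derivative_works)
  have e: "frechet_derivative g (at x) = frechet_derivative f (at x)" if "x \<in> S" for x
    using frechet_derivative_at[OF d[OF that]] by simp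
  have "Cn_on n S (\<lambda>x. frechet_derivative g (at x) v)" for v
  proof (rule Suc.IH)
    show "Cn_on n S (\<lambda>x. frechet_derivative f (at x) v)"
      using Suc.prems(1) by simp
  qed (simp add: e)
  moreover have "\<forall>x\<in>S. g differentiable (at x)"
    using d unfolding differentiable_def by blast
  ultimately show ?case by simp
qed

text \<open>The explicit \<open>f'\<close> agrees with \<open>frechet_derivative\<close> on all of
  the open \<open>S\<close> and may replace it; most closure rules below are proved through this
  form.\<close>

lemma Cn_on_SucI:
  assumes "open S" "\<And>x. x \<in> S \<Longrightarrow> (f has_derivative f' x) (at x)"
    "\<And>v. Cn_on n S (\<lambda>x. f' x v)"
  shows "Cn_on (Suc n) S f"
proof -
  have "f' x = frechet_derivative f (at x)" if "x \<in> S" for x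
    using assms(2) frechet_derivative_at that by blast
  then have "Cn_on n S (\<lambda>x. frechet_derivative f (at x) v)" for v
    by (intro Cn_on_cong[OF assms(1) assms(3)[of v]]) auto
  then show ?thesis
    using assms(2) by (auto simp: differentiable_def)
qed

lemma Cn_on_Suc_D:
  assumes "Cn_on (Suc n) S f" "x \<in> S"
  shows "(f has_derivative frechet_derivative f (at x)) (at x)"
  using assms by (simp add: frechet_derivative_works)

lemma Cn_on_lower: "Cn_on (Suc n) S f \<Longrightarrow> Cn_on n S f"
proof (induction n arbitrary: f)
  case 0
  then show ?case
    by (auto intro!: continuous_at_imp_continuous_on dest: differentiable_imp_continuous_within)
next
  case (Suc n)
  then show ?case by simp
qed

lemma Cn_on_2_D:
  assumes "Cn_on 2 S f" "x \<in> S"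
  shows "(f has_derivative frechet_derivative f (at x)) (at x)"
    and "((\<lambda>z. frechet_derivative f (at z) v) has_derivative
      frechet_derivative (\<lambda>z. frechet_derivative f (at z) v) (at x)) (at x)"
  using assms by (simp_all add: numeral_2_eq_2 frechet_derivative_works[symmetric])

lemma Cn_on_subset: "Cn_on n S f \<Longrightarrow> T \<subseteq> S \<Longrightarrow> Cn_on n T f"
  by (induction n arbitrary: f) (auto intro: continuous_on_subset)

lemma Cn_on_const: "open S \<Longrightarrow> Cn_on n S (\<lambda>x. c)"
proof (induction n arbitrary: c)
  case (Suc n)
  then show ?case
    by (intro Cn_on_SucI[where f' = "\<lambda>x h. 0"]) auto
qed simp

lemma Cn_on_linear:
  assumes "bounded_linear L" "open S"
  shows "Cn_on n S L"
proof (cases n)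
  case 0
  then show ?thesis
    using assms(1) by (simp add: linear_continuous_on)
next
  case (Suc m)
  then show ?thesis
    using assms
    by (auto simp del: Cn_on.simps(2) intro!: Cn_on_SucI[where f' = "\<lambda>x. L"] Cn_on_const
        bounded_linear_imp_has_derivative)
qed

lemma Cn_on_add:
  assumes "open S" "Cn_on n S f" "Cn_on n S g"
  shows "Cn_on n S (\<lambda>x. f x + g x)"
  using assms(2,3)
proof (induction n arbitrary: f g)
  case 0
  then show ?case by (simp add: continuous_on_add)
next
  case (Suc n)
  show ?case
    by (rule Cn_on_SucI[OF assms(1) has_derivative_add[OF Cn_on_Suc_D[OF Suc.prems(1)]
        Cn_on_Suc_D[OF Suc.prems(2)]]]) (use Suc in auto)
qed

lemma Cn_on_sum:
  assumes "open S" "\<And>i. i \<in> I \<Longrightarrow> Cn_on n S (f i)"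
  shows "Cn_on n S (\<lambda>x. \<Sum>i\<in>I. f i x)"
  using assms(2)
  by (induction I rule: infinite_finite_induct)
    (auto intro: Cn_on_add Cn_on_const assms(1))

lemma Cn_on_bilinear:
  assumes "bounded_bilinear P" "open S" "Cn_on n S f" "Cn_on n S g"
  shows "Cn_on n S (\<lambda>x. P (f x) (g x))"
  using assms(3,4)
proof (induction n arbitrary: f g)
  case 0
  then show ?case
    by (simp add: bounded_bilinear.continuous_on[OF assms(1)])
next
  case (Suc n)
  have "Cn_on n S f" "Cn_on n S g"
    using Suc.prems by (auto intro: Cn_on_lower simp del: Cn_on.simps)
  then show ?case
    using Suc
    by (intro Cn_on_SucI[OF assms(2) bounded_bilinear.FDERIV[OF assms(1)
          Cn_on_Suc_D[OF Suc.prems(1)] Cn_on_Suc_D[OF Suc.prems(2)]]])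
      (auto intro!: Cn_on_add[OF assms(2)])
qed

lemmas Cn_on_scaleR = Cn_on_bilinear[OF bounded_bilinear_scaleR]
lemmas Cn_on_mult = Cn_on_bilinear[OF bounded_bilinear_mult]

text \<open>The chain rule yields \<open>f' (g x) (g' x h)\<close>, where point and direction both
  vary with \<open>x\<close>. Expanding the direction in \<open>Basis\<close> leaves derivatives of
  \<open>f\<close> in fixed directions, to which the induction hypothesis applies.\<close>

lemma Cn_on_compose:
  fixes f :: "'b::euclidean_space \<Rightarrow> 'c::real_normed_vector"
  assumes "open S" "open T" "g ` S \<subseteq> T" "Cn_on n T f" "Cn_on n S g"
  shows "Cn_on n S (\<lambda>x. f (g x))"
  using assms(4,5)
proof (induction n arbitrary: f)
  case 0
  then show ?case
    using assms(3) by (auto intro: continuous_on_compose2)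
next
  case (Suc n)
  have gn: "Cn_on n S g"
    using Suc.prems(2) by (rule Cn_on_lower)
  have d: "((\<lambda>x. f (g x)) has_derivative
      (\<lambda>h. \<Sum>b\<in>Basis. (frechet_derivative g (at x) h \<bullet> b) *\<^sub>R frechet_derivative f (at (g x)) b)) (at x)"
    if "x \<in> S" for x
  proof -
    have "g x \<in> T" using assms(3) that by auto
    then have F: "(f has_derivative frechet_derivative f (at (g x))) (at (g x))"
      using Cn_on_Suc_D Suc.prems(1) by blast
    have eq: "frechet_derivative f (at (g x)) w
        = (\<Sum>b\<in>Basis. (w \<bullet> b) *\<^sub>R frechet_derivative f (at (g x)) b)" for w
      using linear_sum[OF has_derivative_linear[OF F], of "\<lambda>b. (w \<bullet> b) *\<^sub>R b" Basis]
        linear_scale[OF has_derivative_linear[OF F]]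
      by (simp add: euclidean_representation)
    show ?thesis
      by (rule has_derivative_eq_rhs[OF has_derivative_compose[OF Cn_on_Suc_D[OF Suc.prems(2) that] F]])
        (rule ext, rule eq)
  qed
  show ?case
  proof (rule Cn_on_SucI[OF assms(1) d])
    fix v
    show "Cn_on n S (\<lambda>x. \<Sum>b\<in>Basis. (frechet_derivative g (at x) v \<bullet> b) *\<^sub>R
        frechet_derivative f (at (g x)) b)"
    proof (intro Cn_on_sum Cn_on_scaleR assms(1))
      fix b :: 'b
      show "Cn_on n S (\<lambda>x. frechet_derivative g (at x) v \<bullet> b)"
        using Suc.prems(2) by (intro Cn_on_bilinear[OF bounded_bilinear_inner] Cn_on_const assms(1)) auto
      show "Cn_on n S (\<lambda>x. frechet_derivative f (at (g x)) b)"
        using Suc.prems(1) by (intro Suc.IH gn) auto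
    qed
  qed
qed

text \<open>Proved jointly, since each function is up to sign the derivative of the other.\<close>

lemma Cn_on_sin_cos:
  "Cn_on n UNIV (sin :: real \<Rightarrow> real) \<and> Cn_on n UNIV (cos :: real \<Rightarrow> real)"
proof (induction n)
  case (Suc n)
  have "Cn_on (Suc n) UNIV (sin :: real \<Rightarrow> real)"
    using Suc
    by (intro Cn_on_SucI[where f' = "\<lambda>x h. h * cos x"])
      (auto intro!: derivative_eq_intros Cn_on_mult Cn_on_const)
  moreover have "Cn_on (Suc n) UNIV (cos :: real \<Rightarrow> real)"
  proof (rule Cn_on_SucI[where f' = "\<lambda>x h. (- h) * sin x"])
    show "Cn_on n UNIV (\<lambda>x. (- v) * sin x)" for v :: real
      using Suc by (intro Cn_on_mult Cn_on_const) auto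
  qed (auto intro!: derivative_eq_intros)
  ultimately show ?case by blast
qed (auto intro: continuous_intros)

subsection \<open>Symmetry of second derivatives\<close>

text \<open>The second difference over the parallelogram spanned by \<open>u\<close> and
  \<open>w\<close> is evaluated by two mean value theorems: along \<open>u\<close> for the
  difference \<open>k\<close>, then along \<open>w\<close> for the first derivative
  \<open>l\<close>.\<close>

lemma mixed_derivative_real_small:
  fixes g :: "'a::euclidean_space \<Rightarrow> real"
  assumes "Cn_on 2 (ball p r) g" "norm u + norm w < r"
  shows "\<exists>q\<in>cball p (norm u + norm w). g (p + u + w) - g (p + u) - g (p + w) + g p
    = frechet_derivative (\<lambda>z. frechet_derivative g (at z) u) (at q) w"
proof -
  let ?D = "\<lambda>z. frechet_derivative g (at z)"
  have d1: "(g has_derivative ?D z) (at z)" if "z \<in> ball p r" for z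
    using Cn_on_2_D(1)[OF assms(1) that] .
  have d2: "((\<lambda>z. ?D z u) has_derivative frechet_derivative (\<lambda>z. ?D z u) (at z)) (at z)"
    if "z \<in> ball p r" for z
    using Cn_on_2_D(2)[OF assms(1) that] .
  have in_ball: "p + s *\<^sub>R u + t *\<^sub>R w \<in> cball p (norm u + norm w)"
    if "0 \<le> s" "s \<le> 1" "0 \<le> t" "t \<le> 1" for s t
  proof -
    have "norm (s *\<^sub>R u + t *\<^sub>R w) \<le> norm (s *\<^sub>R u) + norm (t *\<^sub>R w)"
      by (rule norm_triangle_ineq)
    also have "\<dots> \<le> 1 * norm u + 1 * norm w"
      unfolding norm_scaleR using that by (intro add_mono mult_right_mono) auto
    finally show ?thesis by (simp add: dist_norm algebra_simps norm_minus_commute)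
  qed
  have sub: "cball p (norm u + norm w) \<subseteq> ball p r"
    using assms(2) by auto
  define k where "k s = g (p + s *\<^sub>R u + w) - g (p + s *\<^sub>R u)" for s :: real
  have dk: "(k has_real_derivative ?D (p + s *\<^sub>R u + w) u - ?D (p + s *\<^sub>R u) u) (at s)"
    if "0 \<le> s" "s \<le> 1" for s
  proof -
    have a: "((\<lambda>s. p + s *\<^sub>R u + w) has_derivative (\<lambda>h. h *\<^sub>R u)) (at s)"
      "((\<lambda>s. p + s *\<^sub>R u) has_derivative (\<lambda>h. h *\<^sub>R u)) (at s)"
      by (auto intro!: derivative_eq_intros)
    have "p + s *\<^sub>R u + w \<in> ball p r" "p + s *\<^sub>R u \<in> ball p r"
      using in_ball[of s 1] in_ball[of s 0] that sub by auto
    note d = d1[OF this(1)] d1[OF this(2)]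
    have "(k has_derivative (\<lambda>h. ?D (p + s *\<^sub>R u + w) (h *\<^sub>R u) - ?D (p + s *\<^sub>R u) (h *\<^sub>R u))) (at s)"
      unfolding k_def
      by (rule has_derivative_diff[OF has_derivative_compose[OF a(1) d(1)] has_derivative_compose[OF a(2) d(2)]])
    then show ?thesis
      unfolding has_field_derivative_def
      by (rule has_derivative_eq_rhs)
        (simp add: fun_eq_iff left_diff_distrib right_diff_distrib mult.commute linear_scale[OF has_derivative_linear[OF d(1)]]
          linear_scale[OF has_derivative_linear[OF d(2)]])
  qed
  have "\<exists>s. 0 < s \<and> s < 1 \<and> k 1 - k 0 = (1 - 0) * (?D (p + s *\<^sub>R u + w) u - ?D (p + s *\<^sub>R u) u)"
    by (rule MVT2) (use dk in auto)
  then obtain s where s: "0 < s" "s < 1" "k 1 - k 0 = ?D (p + s *\<^sub>R u + w) u - ?D (p + s *\<^sub>R u) u"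
    by auto
  define l where "l t = ?D (p + s *\<^sub>R u + t *\<^sub>R w) u" for t :: real
  let ?D2 = "\<lambda>z. frechet_derivative (\<lambda>z. ?D z u) (at z)"
  have dl: "(l has_real_derivative ?D2 (p + s *\<^sub>R u + t *\<^sub>R w) w) (at t)"
    if "0 \<le> t" "t \<le> 1" for t
  proof -
    have a: "((\<lambda>t. p + s *\<^sub>R u + t *\<^sub>R w) has_derivative (\<lambda>h. h *\<^sub>R w)) (at t)"
      by (auto intro!: derivative_eq_intros)
    have "p + s *\<^sub>R u + t *\<^sub>R w \<in> ball p r"
      using in_ball[of s t] that s sub by auto
    note d = d2[OF this]
    have "(l has_derivative (\<lambda>h. ?D2 (p + s *\<^sub>R u + t *\<^sub>R w) (h *\<^sub>R w))) (at t)"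
      unfolding l_def by (rule has_derivative_compose[OF a d])
    then show ?thesis
      unfolding has_field_derivative_def
      by (rule has_derivative_eq_rhs)
        (simp add: fun_eq_iff linear_scale[OF has_derivative_linear[OF d]])
  qed
  have "\<exists>t. 0 < t \<and> t < 1 \<and> l 1 - l 0 = (1 - 0) * ?D2 (p + s *\<^sub>R u + t *\<^sub>R w) w"
    by (rule MVT2) (use dl in auto)
  then obtain t where t: "0 < t" "t < 1" "l 1 - l 0 = ?D2 (p + s *\<^sub>R u + t *\<^sub>R w) w"
    by auto
  show ?thesis
    using s t in_ball[of s t]
    by (intro bexI[of _ "p + s *\<^sub>R u + t *\<^sub>R w"]) (auto simp: k_def l_def)
qed

text \<open>The second difference is symmetric in \<open>u\<close> and \<open>w\<close>, so the two
  orders of differentiation agree when taken at suitable points \<open>q1\<close> and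
  \<open>q2\<close> near \<open>p\<close>; continuity at \<open>p\<close> closes the gap.\<close>

lemma mixed_derivative_commute_real:
  fixes g :: "'a::euclidean_space \<Rightarrow> real"
  assumes "open S" "p \<in> S" "Cn_on 2 S g"
  shows "frechet_derivative (\<lambda>z. frechet_derivative g (at z) u) (at p) w
    = frechet_derivative (\<lambda>z. frechet_derivative g (at z) w) (at p) u"
proof -
  let ?D = "\<lambda>u w z. frechet_derivative (\<lambda>z. frechet_derivative g (at z) u) (at z) w"
  obtain r where r: "r > 0" "ball p r \<subseteq> S"
    using assms(1,2) open_contains_ball by blast
  have C: "Cn_on 2 (ball p r) g"
    using assms(3) r(2) Cn_on_subset by blast
  have cont: "isCont (?D u w) p" for u w
    using C r(1) by (auto simp: numeral_2_eq_2 continuous_on_eq_continuous_at)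
  \<comment> \<open>Scaling both directions by \<open>c\<close> produces the factor
    \<open>c * c\<close> in either order, which later cancels.\<close>
  have lin: "?D (c *\<^sub>R u) (c *\<^sub>R w) q = c * c * ?D u w q" if q: "q \<in> ball p r" for q c u w
  proof -
    have d: "((\<lambda>z. frechet_derivative g (at z) u) has_derivative (\<lambda>w. ?D u w q)) (at q)"
      using Cn_on_2_D(2)[OF C q] .
    have "linear (frechet_derivative g (at z))" if "z \<in> ball p r" for z
      using has_derivative_linear[OF Cn_on_2_D(1)[OF C that]] .
    then have "((\<lambda>z. frechet_derivative g (at z) (c *\<^sub>R u)) has_derivative (\<lambda>w. c * ?D u w q)) (at q)"
      by (intro has_derivative_transform_within_open[OF has_derivative_mult_right[OF d] open_ball q])
        (simp add: linear_scale)
    from frechet_derivative_at[OF this] show ?thesis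
      using linear_scale[OF has_derivative_linear[OF d]]
      by (metis mult.assoc real_scaleR_def)
  qed
  have "\<bar>?D u w p - ?D w u p\<bar> \<le> 0"
  proof (rule field_le_epsilon)
    fix \<epsilon> :: real assume e: "\<epsilon> > 0"
    have "\<exists>d>0. \<forall>q. dist q p < d \<longrightarrow> \<bar>?D u w q - ?D u w p\<bar> < \<epsilon>/2" for u w
      using cont[of u w] half_gt_zero[OF e] unfolding continuous_at_eps_delta dist_real_def by blast
    then obtain d1 d2 where d: "d1 > 0" "d2 > 0"
      "\<And>q. dist q p < d1 \<Longrightarrow> \<bar>?D u w q - ?D u w p\<bar> < \<epsilon>/2"
      "\<And>q. dist q p < d2 \<Longrightarrow> \<bar>?D w u q - ?D w u p\<bar> < \<epsilon>/2" by metis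
    \<comment> \<open>Both continuity bounds hold within radius \<open>m\<close>; \<open>c\<close>
      shrinks the parallelogram below it, and the summand 1 avoids a zero denominator for
      \<open>u = w = 0\<close>.\<close>
    define m where "m = min r (min d1 d2)"
    define c where "c = m / (2 * (norm u + norm w + 1))"
    have pos: "norm u + norm w + 1 > 0"
      by (simp add: add_nonneg_pos)
    have m: "m > 0" using r d by (simp add: m_def)
    have c: "c > 0" using m pos by (simp add: c_def)
    have "c * (norm u + norm w) < m"
    proof -
      have "c * (norm u + norm w) < c * (2 * (norm u + norm w + 1))"
        using c by (intro mult_strict_left_mono) (auto simp: add_nonneg_pos)
      also have "\<dots> = m" using pos by (simp add: c_def)
      finally show ?thesis .
    qed
    then have small: "norm (c *\<^sub>R u) + norm (c *\<^sub>R w) < m"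
      using c by (simp add: algebra_simps)
    then have small_r: "norm (c *\<^sub>R u) + norm (c *\<^sub>R w) < r" "norm (c *\<^sub>R w) + norm (c *\<^sub>R u) < r"
      by (auto simp: m_def)
    obtain q1 where q1: "q1 \<in> cball p (norm (c *\<^sub>R u) + norm (c *\<^sub>R w))"
      "g (p + c *\<^sub>R u + c *\<^sub>R w) - g (p + c *\<^sub>R u) - g (p + c *\<^sub>R w) + g p = ?D (c *\<^sub>R u) (c *\<^sub>R w) q1"
      using mixed_derivative_real_small[OF C small_r(1)] by blast
    obtain q2 where q2: "q2 \<in> cball p (norm (c *\<^sub>R w) + norm (c *\<^sub>R u))"
      "g (p + c *\<^sub>R w + c *\<^sub>R u) - g (p + c *\<^sub>R w) - g (p + c *\<^sub>R u) + g p = ?D (c *\<^sub>R w) (c *\<^sub>R u) q2"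
      using mixed_derivative_real_small[OF C small_r(2)] by blast
    have qb: "q1 \<in> ball p r" "q2 \<in> ball p r" "dist q1 p < d1" "dist q2 p < d2"
      using q1(1) q2(1) small by (auto simp: m_def dist_commute)
    have "p + c *\<^sub>R u + c *\<^sub>R w = p + c *\<^sub>R w + c *\<^sub>R u" by simp
    then have "?D (c *\<^sub>R u) (c *\<^sub>R w) q1 = ?D (c *\<^sub>R w) (c *\<^sub>R u) q2"
      using q1(2) q2(2) by (metis add.commute diff_diff_eq)
    then have "?D u w q1 = ?D w u q2"
      using lin qb(1,2) c by simp
    then show "\<bar>?D u w p - ?D w u p\<bar> \<le> 0 + \<epsilon>"
      using d(3)[OF qb(3)] d(4)[OF qb(4)] by linarith
  qed
  then show ?thesis by simp
qed

lemma mixed_derivative_commute: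
  fixes g :: "'a::euclidean_space \<Rightarrow> 'b::real_inner"
  assumes "open S" "p \<in> S" "Cn_on 2 S g"
  shows "frechet_derivative (\<lambda>z. frechet_derivative g (at z) u) (at p) w
    = frechet_derivative (\<lambda>z. frechet_derivative g (at z) w) (at p) u"
proof -
  have d1: "(g has_derivative frechet_derivative g (at z)) (at z)" if "z \<in> S" for z
    using Cn_on_2_D(1)[OF assms(3) that] .
  have eq: "frechet_derivative (\<lambda>z. frechet_derivative (\<lambda>z. g z \<bullet> b) (at z) u) (at p) w
      = frechet_derivative (\<lambda>z. frechet_derivative g (at z) u) (at p) w \<bullet> b" for b u w
  proof -
    have "((\<lambda>z. g z \<bullet> b) has_derivative (\<lambda>h. frechet_derivative g (at z) h \<bullet> b)) (at z)"
      if "z \<in> S" for z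
      using has_derivative_inner_left[OF d1[OF that]] .
    then have e: "frechet_derivative g (at z) u \<bullet> b = frechet_derivative (\<lambda>z. g z \<bullet> b) (at z) u"
      if "z \<in> S" for z
      using frechet_derivative_at that by metis
    have "((\<lambda>z. frechet_derivative g (at z) u) has_derivative
        frechet_derivative (\<lambda>z. frechet_derivative g (at z) u) (at p)) (at p)"
      using Cn_on_2_D(2)[OF assms(3,2)] .
    from has_derivative_transform_within_open[OF has_derivative_inner_left[OF this] assms(1,2) e]
    show ?thesis
      by (rule frechet_derivative_at[symmetric, THEN fun_cong])
  qed
  have "Cn_on 2 S (\<lambda>z. g z \<bullet> b)" for b
    using assms by (intro Cn_on_bilinear[OF bounded_bilinear_inner] Cn_on_const)
  from mixed_derivative_commute_real[OF assms(1,2) this, unfolded eq]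
  show ?thesis by (rule vector_eq_rdot[THEN iffD1, OF allI])
qed

lemma second_differential_linear:
  assumes "open S" "Cn_on 2 S F" "v \<in> S"
  shows "linear (\<lambda>w. second_differential F v w u)" "linear (second_differential F v w)"
proof -
  have d1: "linear (frechet_derivative F (at z))" if "z \<in> S" for z
    using has_derivative_linear[OF Cn_on_2_D(1)[OF assms(2) that]] .
  note d2 = Cn_on_2_D(2)[OF assms(2,3)]
  show "linear (second_differential F v w)"
    unfolding second_differential_def by (rule has_derivative_linear[OF d2])
  show "linear (\<lambda>w. second_differential F v w u)"
  proof (rule linearI)
    fix w1 w2
    have "((\<lambda>z. frechet_derivative F (at z) (w1 + w2)) has_derivative
        (\<lambda>u. second_differential F v w1 u + second_differential F v w2 u)) (at v)"
      unfolding second_differential_def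
      by (rule has_derivative_transform_within_open[OF has_derivative_add[OF d2 d2] assms(1,3)])
        (simp add: linear_add[OF d1])
    from fun_cong[OF frechet_derivative_at[OF this], of u]
    show "second_differential F v (w1 + w2) u = second_differential F v w1 u + second_differential F v w2 u"
      by (simp add: second_differential_def)
  next
    fix c w
    have "((\<lambda>z. frechet_derivative F (at z) (c *\<^sub>R w)) has_derivative
        (\<lambda>u. c * second_differential F v w u)) (at v)"
      unfolding second_differential_def
      by (rule has_derivative_transform_within_open[OF has_derivative_mult_right[OF d2] assms(1,3)])
        (simp add: linear_scale[OF d1])
    from fun_cong[OF frechet_derivative_at[OF this], of u]
    show "second_differential F v (c *\<^sub>R w) u = c *\<^sub>R second_differential F v w u"
      by (simp add: second_differential_def)
  qed
qed

text \<open>A product and chain rule with base point and vector both moving; expanding the vector in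
  \<open>Basis\<close> reduces it to differentials in fixed directions.\<close>

lemma has_derivative_differential:
  fixes F :: "'a::euclidean_space \<Rightarrow> real"
  assumes "open S" "Cn_on 2 S F" "z p \<in> S"
    and z: "(z has_derivative z') (at p)" and w: "(w has_derivative w') (at p)"
  shows "((\<lambda>q. frechet_derivative F (at (z q)) (w q)) has_derivative
    (\<lambda>h. frechet_derivative F (at (z p)) (w' h) + second_differential F (z p) (w p) (z' h))) (at p)"
proof -
  let ?D = "\<lambda>v. frechet_derivative F (at v)"
  have expand: "T x = (\<Sum>b\<in>Basis. (x \<bullet> b) * T b)" if "linear T" for x and T :: "'a \<Rightarrow> real"
    using linear_sum[OF that, of "\<lambda>b. (x \<bullet> b) *\<^sub>R b" Basis] linear_scale[OF that]
    by (simp add: euclidean_representation)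
  have lin: "linear (?D v)" if "v \<in> S" for v
    using has_derivative_linear[OF Cn_on_2_D(1)[OF assms(2) that]] .
  have "((\<lambda>q. ?D (z q) b) has_derivative (\<lambda>h. second_differential F (z p) b (z' h))) (at p)" for b
    unfolding second_differential_def
    using has_derivative_compose[OF z Cn_on_2_D(2)[OF assms(2,3)]] .
  then have "((\<lambda>q. \<Sum>b\<in>Basis. (w q \<bullet> b) * ?D (z q) b) has_derivative
      (\<lambda>h. \<Sum>b\<in>Basis. (w p \<bullet> b) * second_differential F (z p) b (z' h) + (w' h \<bullet> b) * ?D (z p) b)) (at p)"
    by (intro has_derivative_sum has_derivative_mult has_derivative_inner_left w)
  moreover have "(\<Sum>b\<in>Basis. (w p \<bullet> b) * second_differential F (z p) b (z' h) + (w' h \<bullet> b) * ?D (z p) b)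
      = ?D (z p) (w' h) + second_differential F (z p) (w p) (z' h)" for h
    using expand[OF lin[OF assms(3)], of "w' h"]
      expand[OF second_differential_linear(1)[OF assms(1-3), of "z' h"], of "w p"]
    by (simp add: sum.distrib)
  ultimately have d: "((\<lambda>q. \<Sum>b\<in>Basis. (w q \<bullet> b) * ?D (z q) b) has_derivative
      (\<lambda>h. ?D (z p) (w' h) + second_differential F (z p) (w p) (z' h))) (at p)"
    by simp
  have "\<exists>N. open N \<and> p \<in> N \<and> (\<forall>q\<in>N. z q \<in> S)"
    using has_derivative_continuous[OF z, unfolded continuous_at_open, rule_format, of S] assms(1,3)
    by simp
  then obtain N where N: "open N" "p \<in> N" "\<And>q. q \<in> N \<Longrightarrow> z q \<in> S"
    by auto
  show ?thesis
    by (rule has_derivative_transform_within_open[OF d N(1,2)])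
      (rule expand[OF lin[OF N(3)], symmetric])
qed

subsection \<open>Squares of Minkowski norms\<close>

text \<open>Instantiated twice later: with the square of the norm on the plane and with that of the
  norm on the target.\<close>

locale minkowski_square =
  fixes F :: "'a::euclidean_space \<Rightarrow> real"
  assumes smooth: "Cn_on 2 (UNIV - {0}) F"
    and homogeneous: "\<And>t v. t \<ge> 0 \<Longrightarrow> F (t *\<^sub>R v) = t\<^sup>2 * F v"
    and pos: "\<And>v. v \<noteq> 0 \<Longrightarrow> F v > 0"
    and convex: "\<And>v w. v \<noteq> 0 \<Longrightarrow> w \<noteq> 0 \<Longrightarrow> second_differential F v w w > 0"
begin

abbreviation D :: "'a \<Rightarrow> 'a \<Rightarrow> real" where
  "D v \<equiv> frechet_derivative F (at v)"

lemma zero: "F 0 = 0"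
  using homogeneous[of 0 0] by simp

lemma open_punctured: "open (UNIV - {0::'a})"
  by (simp add: open_delete)

lemma has_derivative: "v \<noteq> 0 \<Longrightarrow> (F has_derivative D v) (at v)"
  using Cn_on_2_D(1)[OF smooth] by simp

lemma linear_D: "v \<noteq> 0 \<Longrightarrow> linear (D v)"
  using has_derivative has_derivative_linear by blast

lemma linear_sd:
  "v \<noteq> 0 \<Longrightarrow> linear (\<lambda>w. second_differential F v w u)"
  "v \<noteq> 0 \<Longrightarrow> linear (second_differential F v w)"
  using second_differential_linear[OF open_punctured smooth] by simp_all

lemma has_derivative_D:
  assumes "z p \<noteq> 0" "(z has_derivative z') (at p)" "(w has_derivative w') (at p)"
  shows "((\<lambda>q. D (z q) (w q)) has_derivative
    (\<lambda>h. D (z p) (w' h) + second_differential F (z p) (w p) (z' h))) (at p)"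
  using has_derivative_differential[OF open_punctured smooth _ assms(2,3)] assms(1) by simp

text \<open>Differentiate \<open>F (t *\<^sub>R v) = t\<^sup>2 * F v\<close> at
  \<open>t = 1\<close>.\<close>

lemma euler: 
  assumes "v \<noteq> 0"
  shows "D v v = 2 * F v"
proof -
  have "((\<lambda>t. t *\<^sub>R v) has_derivative (\<lambda>h. h *\<^sub>R v)) (at 1)"
    by (auto intro!: derivative_eq_intros)
  from has_derivative_compose[OF this, of F "D v"] assms
  have "((\<lambda>t. F (t *\<^sub>R v)) has_derivative (\<lambda>h. D v (h *\<^sub>R v))) (at 1)"
    using has_derivative by simp
  \<comment> \<open>Homogeneity is available for nonnegative factors only, hence the neighbourhood
    \<open>{0<..}\<close> of 1.\<close>
  then have "((\<lambda>t. t\<^sup>2 * F v) has_derivative (\<lambda>h. D v (h *\<^sub>R v))) (at 1)"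
    by (rule has_derivative_transform_within_open[of _ _ _ _ "{0<..}"]) (auto simp: homogeneous)
  moreover have "((\<lambda>t. t\<^sup>2 * F v) has_derivative (\<lambda>h. 2 * h * F v)) (at 1)"
    by (auto intro!: derivative_eq_intros)
  ultimately have "(\<lambda>h. D v (h *\<^sub>R v)) = (\<lambda>h. 2 * h * F v)"
    by (rule has_derivative_unique)
  from fun_cong[OF this, of 1] show ?thesis by simp
qed

lemma D_scale:
  assumes "v \<noteq> 0" "t > 0"
  shows "D (t *\<^sub>R v) w = t * D v w"
proof -
  have "((\<lambda>z. F (t *\<^sub>R z)) has_derivative (\<lambda>w. D (t *\<^sub>R v) (t *\<^sub>R w))) (at v)"
    using assms by (intro has_derivative_compose[OF _ has_derivative])
      (auto intro!: derivative_eq_intros)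
  moreover have "((\<lambda>z. F (t *\<^sub>R z)) has_derivative (\<lambda>w. t\<^sup>2 * D v w)) (at v)"
    using assms has_derivative_mult_right[OF has_derivative[OF assms(1)], of "t\<^sup>2"]
    by (simp add: homogeneous)
  ultimately have "(\<lambda>w. D (t *\<^sub>R v) (t *\<^sub>R w)) = (\<lambda>w. t\<^sup>2 * D v w)"
    by (rule has_derivative_unique)
  from fun_cong[OF this, of w] show ?thesis
    using assms linear_scale[OF linear_D[of "t *\<^sub>R v"]] by (simp add: power2_eq_square)
qed

text \<open>Differentiate \<open>D_scale\<close> at \<open>t = 1\<close>: the differential is
  homogeneous of degree one in the base point.\<close>

lemma sd_radial:
  assumes "v \<noteq> 0"
  shows "second_differential F v w v = D v w"
proof -
  have a: "((\<lambda>t. t *\<^sub>R v) has_derivative (\<lambda>h. h *\<^sub>R v)) (at 1)"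
    by (auto intro!: derivative_eq_intros)
  have "((\<lambda>t. D (t *\<^sub>R v) w) has_derivative (\<lambda>h. D v 0 + second_differential F v w (h *\<^sub>R v))) (at 1)"
    using has_derivative_D[OF _ a has_derivative_const[of w]] assms by simp
  then have "((\<lambda>t. t * D v w) has_derivative (\<lambda>h. D v 0 + second_differential F v w (h *\<^sub>R v))) (at 1)"
    by (rule has_derivative_transform_within_open[of _ _ _ _ "{0<..}"]) (auto simp: D_scale assms)
  moreover have "((\<lambda>t. t * D v w) has_derivative (\<lambda>h. h * D v w)) (at 1)"
    by (auto intro!: derivative_eq_intros)
  ultimately have "(\<lambda>h. D v 0 + second_differential F v w (h *\<^sub>R v)) = (\<lambda>h. h * D v w)"
    by (rule has_derivative_unique)
  from fun_cong[OF this, of 1] show ?thesis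
    using linear_0[OF linear_D[OF assms]] by simp
qed

text \<open>By Euler's identity the radial direction is transversal to the level sets of
  \<open>F\<close>.\<close>

lemma eigenvector_tangent_imp_zero:
  assumes "u \<noteq> 0" "D u (c *\<^sub>R u) = 0"
  shows "c = 0"
  using assms euler[of u] pos[of u] linear_scale[OF linear_D[of u]] by simp

end

subsection \<open>Polynomial fields tangent to a planar indicatrix\<close>

locale planar_minkowski_square = minkowski_square F for F :: "real \<times> real \<Rightarrow> real" +
  assumes not_inner_product: "\<not> (\<exists>B. inner_product B \<and> (\<forall>v. F v = B v v))"
begin

text \<open>Dividing a tangent field by the linear form \<open>u \<bullet> n\<close> gives tangency
  only off the line where that form vanishes; approaching the line along \<open>n\<close> recovers
  it there by continuity.\<close>

lemma tangent_off_line: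
  assumes M: "\<And>u. M differentiable (at u)"
    and n: "n \<noteq> 0" "\<And>u. u \<bullet> n \<noteq> 0 \<Longrightarrow> D u (M u) = 0" and "u \<noteq> 0"
  shows "D u (M u) = 0"
proof (cases "u \<bullet> n = 0")
  case True
  define z where "z s = u + s *\<^sub>R n" for s :: real
  have z: "(z has_derivative (\<lambda>s. s *\<^sub>R n)) (at 0)"
    unfolding z_def by (auto intro!: derivative_eq_intros)
  obtain M' where M': "(M has_derivative M') (at (z 0))"
    using M unfolding differentiable_def by blast
  have "isCont (\<lambda>s. D (z s) (M (z s))) 0"
    using has_derivative_continuous[OF has_derivative_D[OF _ z has_derivative_compose[OF z M']]] assms(4)
    by (simp add: z_def)
  then have lim: "((\<lambda>s. D (z s) (M (z s))) \<longlongrightarrow> D u (M u)) (at 0)"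
    by (simp add: isCont_def z_def)
  have "z s \<bullet> n \<noteq> 0" if "s \<noteq> 0" for s
    using True n(1) that by (simp add: z_def inner_add_left)
  then have "eventually (\<lambda>s. D (z s) (M (z s)) = 0) (at 0)"
    using n(2) by (auto simp: eventually_at_filter)
  then have "((\<lambda>s. D (z s) (M (z s))) \<longlongrightarrow> 0) (at 0)"
    by (rule tendsto_eventually)
  then show ?thesis
    using lim LIM_unique by blast
qed (use n in simp)

text \<open>Such an \<open>A\<close> has rank at most one,
  \<open>A u = (u \<bullet> n) *\<^sub>R w\<close>. If \<open>w\<close> were nonzero, this fixed
  vector would be tangent to the level sets everywhere, also at the point \<open>w\<close> itself,
  against Euler's identity.\<close>

lemma tangent_linear_with_kernel_eq_0:
  assumes A: "linear A" and t: "\<And>u. u \<noteq> 0 \<Longrightarrow> D u (A u) = 0" and k: "k \<noteq> 0" "A k = 0"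
  shows "A u = 0"
proof -
  obtain p q where k_eq: "k = (p, q)" by fastforce
  define n where "n = (q, - p)"
  have n: "n \<noteq> 0" using k k_eq by (auto simp: n_def zero_prod_def)
  have pq: "p * p + q * q \<noteq> 0"
    using k(1) by (auto simp: k_eq zero_prod_def sum_squares_eq_zero_iff)
  define w where "w = (1 / (p * p + q * q)) *\<^sub>R A n"
  have Au: "A u = (u \<bullet> n) *\<^sub>R w" for u
  proof -
    obtain x y where u: "u = (x, y)" by fastforce
    \<comment> \<open>\<open>n\<close> is \<open>k\<close> turned by a right angle, so the two are
      orthogonal and of equal length, and \<open>A\<close> kills the \<open>k\<close>-part.\<close>
    have "(p * p + q * q) *\<^sub>R u = (u \<bullet> n) *\<^sub>R n + (u \<bullet> k) *\<^sub>R k"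
      by (simp add: u n_def k_eq algebra_simps)
    then have "A ((p * p + q * q) *\<^sub>R u) = A ((u \<bullet> n) *\<^sub>R n + (u \<bullet> k) *\<^sub>R k)"
      by (rule arg_cong)
    then have "(p * p + q * q) *\<^sub>R A u = (p * p + q * q) *\<^sub>R ((u \<bullet> n) *\<^sub>R w)"
      using k(2) pq by (simp add: linear_add[OF A] linear_scale[OF A] w_def)
    then show ?thesis
      using pq by (simp only: scaleR_cancel_left) simp
  qed
  have "D u w = 0" if "u \<bullet> n \<noteq> 0" for u
  proof -
    have "u \<noteq> 0" using that by auto
    then show ?thesis
      using t[of u] that linear_scale[OF linear_D] by (simp add: Au)
  qed
  then have "D w w = 0" if "w \<noteq> 0"
    using tangent_off_line[of "\<lambda>_. w" n w] n that by simp
  then have "w = 0"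
    using euler[of w] pos[of w] by fastforce
  then show ?thesis by (simp add: Au)
qed

text \<open>An \<open>A\<close> with a kernel falls under the rank-one case. Otherwise Euler's
  identity excludes real eigenvectors, and \<open>F\<close> turns out to be a multiple of the
  definite form given by \<open>u \<and> A u\<close>, contradicting
  \<open>not_inner_product\<close>.\<close>

lemma tangent_linear_eq_0:
  assumes A: "linear A" and t: "\<And>u. u \<noteq> 0 \<Longrightarrow> D u (A u) = 0"
  shows "A u = 0"
proof (cases "\<exists>k. k \<noteq> 0 \<and> A k = 0")
  case True
  then show ?thesis using tangent_linear_with_kernel_eq_0[OF A t] by blast
next
  case False
  obtain a c where ac: "A (1, 0) = (a, c)" by fastforce
  obtain b d where bd: "A (0, 1) = (b, d)" by fastforce
  have A_eq: "A (x, y) = (a * x + b * y, c * x + d * y)" for x y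
  proof -
    have "A (x, y) = A (x *\<^sub>R (1, 0) + y *\<^sub>R (0, 1))" by simp
    also have "\<dots> = x *\<^sub>R (a, c) + y *\<^sub>R (b, d)"
      by (simp only: linear_add[OF A] linear_scale[OF A] ac bd)
    finally show ?thesis by (simp add: mult.commute)
  qed
  have no_eigen: False if "u \<noteq> 0" "A u = l *\<^sub>R u" for u l
  proof -
    have "l = 0" using eigenvector_tangent_imp_zero[of u l] t[of u] that by simp
    then show False using that False by (metis scaleR_zero_left)
  qed
  \<comment> \<open>The form is \<open>u \<and> A u\<close> for \<open>u = (x, y)\<close>; a
    nontrivial zero is an eigenvector of \<open>A\<close>.\<close>
  have wedge: False if "c * x * x + (d - a) * x * y - b * y * y = 0" "x \<noteq> 0 \<or> y \<noteq> 0" for x y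
  proof (cases "x = 0")
    case True
    then show False using that no_eigen[of "(x, y)" d] by (simp add: A_eq zero_prod_def)
  next
    case x: False
    have "A (x, y) = (a + b * (y / x)) *\<^sub>R (x, y)"
      using that x by (simp add: A_eq field_simps)
    moreover have "(x, y) \<noteq> 0" using x by (simp add: zero_prod_def)
    ultimately show False using no_eigen by blast
  qed
  have c: "c \<noteq> 0" using wedge[of 1 0] by auto
  \<comment> \<open>A nonnegative discriminant would give the form a root \<open>x\<close> at
    \<open>y = 1\<close>.\<close>
  have disc: "(d - a)\<^sup>2 + 4 * b * c < 0"
  proof (rule ccontr)
    define r where "r = sqrt ((d - a)\<^sup>2 + 4 * b * c)"
    assume "\<not> ?thesis"
    then have r2: "r * r = (d - a) * (d - a) + 4 * b * c"
      by (simp add: r_def power2_eq_square)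
    define x where "x = (r - (d - a)) / (2 * c)"
    have "2 * c * x = r - (d - a)" using c by (simp add: x_def)
    then have "4 * c * (c * x * x + (d - a) * x * 1 - b * 1 * 1) = 0"
      using r2 by algebra
    then show False using wedge[of x 1] c by auto
  qed
  text \<open>
    The form \<open>q u = c (u \<and> A u)\<close> is definite since \<open>A\<close> has no eigenvector, and its derivative along
    \<open>A u\<close> is \<open>(tr A) q u\<close>. The 0-homogeneous quotient \<open>F / q\<close> has a critical point, so \<open>tr A = 0\<close>, and
    then \<open>F / q\<close> must be constant.
  \<close>
  define q where "q u = c\<^sup>2 * (fst u)\<^sup>2 + c * (d - a) * (fst u * snd u) - b * c * (snd u)\<^sup>2" for u :: "real \<times> real"
  define q' where "q' u h = c\<^sup>2 * (2 * fst u * fst h) + c * (d - a) * (fst u * snd h + fst h * snd u)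
    - b * c * (2 * snd u * snd h)" for u h :: "real \<times> real"
  have q_pos: "q u > 0" if "u \<noteq> 0" for u
  proof -
    have e: "q u = (c * fst u + (d - a) / 2 * snd u)\<^sup>2 + (- ((d - a)\<^sup>2 + 4 * b * c) / 4) * (snd u)\<^sup>2"
      by (simp add: q_def power2_eq_square field_simps)
    show ?thesis
    proof (cases "snd u = 0")
      case True
      then have "fst u \<noteq> 0" using that by (auto simp: prod_eq_iff)
      then show ?thesis using True c by (simp add: q_def)
    next
      case False
      then have "(- ((d - a)\<^sup>2 + 4 * b * c) / 4) * (snd u)\<^sup>2 > 0"
        using disc by (intro mult_pos_pos) auto
      then show ?thesis unfolding e by (simp add: add_nonneg_pos)
    qed
  qed
  have dq: "(q has_derivative q' u) (at u)" for u
    unfolding q_def q'_def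
    by (auto intro!: derivative_eq_intros simp: fun_eq_iff algebra_simps power2_eq_square)
  have q'_A: "q' u (A u) = (a + d) * q u" for u
    by (cases u) (simp add: q'_def q_def A_eq power2_eq_square algebra_simps)
  have q'_radial: "q' u u = 2 * q u" for u
    by (simp add: q'_def q_def power2_eq_square algebra_simps)
  define \<psi> where "\<psi> u = F u / q u" for u
  define \<psi>' where "\<psi>' u h = (D u h * q u - F u * q' u h) / (q u * q u)" for u h
  have d\<psi>: "(\<psi> has_derivative \<psi>' u) (at u)" if "u \<noteq> 0" for u
    unfolding \<psi>_def \<psi>'_def using has_derivative_divide'[OF has_derivative[OF that] dq[of u]] q_pos[OF that] by simp
  have \<psi>'_A: "\<psi>' u (A u) = - (F u * (a + d) / q u)" if "u \<noteq> 0" for u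
    using q_pos[OF that] t[OF that] by (simp add: \<psi>'_def q'_A)
  have \<psi>_scale: "\<psi> (s *\<^sub>R u) = \<psi> u" if "s > 0" for s u
  proof -
    have "q (s *\<^sub>R u) = s\<^sup>2 * q u" by (simp add: q_def power2_eq_square algebra_simps)
    then show ?thesis using that by (simp add: \<psi>_def homogeneous)
  qed
  have "continuous_on (sphere 0 1) \<psi>"
    by (intro continuous_at_imp_continuous_on ballI has_derivative_continuous[OF d\<psi>]) auto
  moreover have "sphere (0 :: real \<times> real) 1 \<noteq> {}" by simp
  ultimately obtain m where m: "m \<in> sphere 0 1" "\<And>u. u \<in> sphere 0 1 \<Longrightarrow> \<psi> u \<le> \<psi> m"
    using continuous_attains_sup[of "sphere 0 1" \<psi>] by auto
  have m0: "m \<noteq> 0" using m(1) by auto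
  \<comment> \<open>Invariance under positive scaling turns the maximum over the unit sphere into
    one over the punctured plane, where the differential must vanish.\<close>
  have "\<psi> u \<le> \<psi> m" if "u \<noteq> 0" for u
    using m(2)[of "(1 / norm u) *\<^sub>R u"] \<psi>_scale[of "1 / norm u" u] that by simp
  then have "\<psi>' m = (\<lambda>v. 0)"
    by (intro differential_zero_maxmin[OF _ open_punctured d\<psi>[OF m0]]) (use m0 in auto)
  then have "F m * (a + d) / q m = 0"
    using \<psi>'_A[OF m0] by simp
  then have tr: "a + d = 0"
    using pos[OF m0] q_pos[OF m0] by auto
  have "\<psi>' u = (\<lambda>h. 0)" if u: "u \<noteq> 0" for u
  proof
    fix h :: "real \<times> real"
    have lin: "linear (\<psi>' u)" using has_derivative_linear[OF d\<psi>[OF u]] .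
    have z1: "\<psi>' u u = 0"
      using euler[OF u] by (simp add: \<psi>'_def q'_radial)
    have z2: "\<psi>' u (A u) = 0" using \<psi>'_A[OF u] tr by simp
    obtain x y where xy: "u = (x, y)" by fastforce
    obtain h1 h2 :: real where h: "h = (h1, h2)" by fastforce
    define e where "e = c * x * x + (d - a) * x * y - b * y * y"
    have e: "e \<noteq> 0" using wedge[of x y] u by (auto simp: e_def xy zero_prod_def)
    \<comment> \<open>Cramer's rule in the basis \<open>u\<close>, \<open>A u\<close>: the
      coefficients are \<open>h \<and> A u\<close> and \<open>u \<and> h\<close>, the determinant is
      \<open>e\<close>.\<close>
    have "e *\<^sub>R h = (h1 * (c * x + d * y) - h2 * (a * x + b * y)) *\<^sub>R u + (x * h2 - y * h1) *\<^sub>R A u"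
      by (simp add: xy h A_eq e_def algebra_simps)
    then have "\<psi>' u (e *\<^sub>R h) = 0"
      by (simp add: linear_add[OF lin] linear_scale[OF lin] z1 z2)
    then show "\<psi>' u h = 0" using e by (simp add: linear_scale[OF lin])
  qed
  then have der: "(\<psi> has_derivative (\<lambda>h. 0)) (at u)" if "u \<in> UNIV - {0}" for u
    using d\<psi>[of u] that by simp
  have conn: "connected (UNIV - {0 :: real \<times> real})"
    using connected_punctured_universe[of "0 :: real \<times> real"] by (simp add: Compl_eq_Diff_UNIV)
  define C where "C = \<psi> (1, 0)"
  have C: "\<psi> u = C" if "u \<in> UNIV - {0}" for u
    using has_derivative_zero_unique_connected[OF open_punctured conn der that, of "(1, 0)"]
    by (simp add: C_def zero_prod_def)
  have F_eq: "F u = C * q u" for u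
    using C[of u] q_pos[of u] zero by (cases "u = 0") (auto simp: \<psi>_def q_def field_simps)
  \<comment> \<open>\<open>q'\<close> is twice the polar form of \<open>q\<close>, whence the factor
    \<open>C / 2\<close>.\<close>
  define B where "B u v = C / 2 * q' u v" for u v
  have "inner_product B"
    unfolding inner_product_def
  proof (intro conjI allI impI)
    show "bilinear B"
      unfolding bilinear_def linear_iff by (simp add: B_def q'_def algebra_simps)
    show "B v w = B w v" for v w by (simp add: B_def q'_def algebra_simps)
    show "B v v > 0" if "v \<noteq> 0" for v
      using F_eq[of v] pos[OF that] by (simp add: B_def q'_radial)
  qed
  moreover have "F v = B v v" for v
    by (simp add: F_eq B_def q'_radial)
  ultimately show ?thesis using not_inner_product by blast
qed

text \<open>The cubic form \<open>u \<and> B u u\<close> has odd degree, hence a real zero. There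
  \<open>B u u\<close> is radial, so zero by Euler's identity, and a linear factor splits off; the
  linear cofactor is again tangent to the level sets and vanishes.\<close>

lemma tangent_quadratic_eq_0:
  assumes B: "bilinear B" and t: "\<And>u. u \<noteq> 0 \<Longrightarrow> D u (B u u) = 0"
  shows "B u u = 0"
proof -
  define c1 c2 c3 where "c1 = B (1, 0) (1, 0)" and "c2 = B (1, 0) (0, 1) + B (0, 1) (1, 0)"
    and "c3 = B (0, 1) (0, 1)"
  have B_eq: "B (x, y) (x, y) = (x * x) *\<^sub>R c1 + (x * y) *\<^sub>R c2 + (y * y) *\<^sub>R c3" for x y
  proof -
    have "B (x, y) (x, y) = B (x *\<^sub>R (1, 0) + y *\<^sub>R (0, 1)) (x *\<^sub>R (1, 0) + y *\<^sub>R (0, 1))"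
      by simp
    also have "\<dots> = x *\<^sub>R x *\<^sub>R c1 + (x *\<^sub>R y *\<^sub>R c2 + y *\<^sub>R y *\<^sub>R c3)"
      by (simp only: bilinear_ladd[OF B] bilinear_radd[OF B] bilinear_lmul[OF B] bilinear_rmul[OF B]
          c1_def c2_def c3_def) (simp add: algebra_simps)
    finally show ?thesis by simp
  qed
  \<comment> \<open>The cubic form on the unit circle; its oddness gives
    \<open>P pi = - P 0\<close>, so the intermediate value theorem applies.\<close>
  define P where "P s = cos s * snd (B (cos s, sin s) (cos s, sin s))
    - sin s * fst (B (cos s, sin s) (cos s, sin s))" for s
  have "continuous_on {0..pi} P"
    unfolding P_def B_eq by (auto intro!: continuous_intros)
  moreover have "P pi = - P 0" by (simp add: P_def B_eq)
  ultimately obtain s where s: "P s = 0"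
    using IVT'[of P 0 0 pi] IVT2'[of P pi 0 0] pi_ge_zero
    by (metis le_cases neg_0_le_iff_le neg_le_0_iff_le)
  define x y where "x = cos s" and "y = sin s"
  have xy: "x * x + y * y = 1"
    using sin_cos_squared_add3[of s] by (simp add: x_def y_def)
  then have xy0: "(x, y) \<noteq> 0"
    by (auto simp: zero_prod_def)
  define l where "l = x * fst (B (x, y) (x, y)) + y * snd (B (x, y) (x, y))"
  have "x * snd (B (x, y) (x, y)) = y * fst (B (x, y) (x, y))"
    using s by (simp add: P_def x_def y_def)
  then have "l * x = fst (B (x, y) (x, y))" "l * y = snd (B (x, y) (x, y))"
    using xy unfolding l_def by algebra+
  then have "B (x, y) (x, y) = l *\<^sub>R (x, y)"
    by (simp add: prod_eq_iff)
  then have B0: "B (x, y) (x, y) = 0"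
    using eigenvector_tangent_imp_zero[OF xy0, of l] t[OF xy0] by (metis scaleR_zero_left)
  text \<open>Hence \<open>B u u\<close> is divisible by the linear form vanishing at \<open>(x, y)\<close>.\<close>
  have "\<exists>m1 m2. c1 = y *\<^sub>R m1 \<and> c2 = y *\<^sub>R m2 - x *\<^sub>R m1 \<and> c3 = - x *\<^sub>R m2"
  proof (cases "y = 0")
    case True
    then have "x \<noteq> 0" "c1 = 0" using xy B0 by (auto simp: B_eq)
    then show ?thesis using True
      by (intro exI[of _ "- (1 / x) *\<^sub>R c2"] exI[of _ "- (1 / x) *\<^sub>R c3"]) simp
  next
    case False
    define m1 where "m1 = (1 / y) *\<^sub>R c1"
    define m2 where "m2 = (1 / y) *\<^sub>R (c2 + x *\<^sub>R m1)"
    have c: "c1 = y *\<^sub>R m1" "c2 = y *\<^sub>R m2 - x *\<^sub>R m1"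
      using False by (simp_all add: m1_def m2_def)
    have "(y * y) *\<^sub>R (c3 + x *\<^sub>R m2) = 0"
      using B0 unfolding B_eq c by (simp add: algebra_simps)
    then have "c3 = - x *\<^sub>R m2"
      using False by (simp add: eq_neg_iff_add_eq_0)
    then show ?thesis using c by blast
  qed
  then obtain m1 m2 where m: "c1 = y *\<^sub>R m1" "c2 = y *\<^sub>R m2 - x *\<^sub>R m1" "c3 = - x *\<^sub>R m2"
    by blast
  define M where "M u = fst u *\<^sub>R m1 + snd u *\<^sub>R m2" for u :: "real \<times> real"
  define n where "n = (y, - x)"
  \<comment> \<open>The form \<open>u \<bullet> n\<close> vanishes along the line through
    \<open>(x, y)\<close>; \<open>m1\<close> and \<open>m2\<close> come from comparing
    \<open>(u \<bullet> n) *\<^sub>R M u\<close> with \<open>c1\<close>, \<open>c2\<close>,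
    \<open>c3\<close>.\<close>
  have B_M: "B u u = (u \<bullet> n) *\<^sub>R M u" for u
    by (cases u) (simp add: B_eq m n_def M_def algebra_simps)
  have n: "n \<noteq> 0" using xy0 by (auto simp: n_def zero_prod_def)
  have linM: "linear M"
    by (auto simp: linear_iff M_def algebra_simps)
  have off: "D u (M u) = 0" if "u \<bullet> n \<noteq> 0" for u
  proof -
    have "u \<noteq> 0" using that by auto
    then show ?thesis
      using t[of u] that linear_scale[OF linear_D] by (simp add: B_M)
  qed
  have "M u = 0"
    using tangent_linear_eq_0[OF linM tangent_off_line[OF linear_imp_differentiable[OF linM] n off]] .
  then show ?thesis by (simp add: B_M)
qed

end

section \<open>Linear maps depending on a parameter, and planes in three dimensions\<close>

lemma has_derivative_linear_apply:
  fixes L :: "'a::real_normed_vector \<Rightarrow> real \<times> real \<Rightarrow> 'b::real_normed_vector"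
  assumes "open S" "p \<in> S" and lin: "\<And>q. q \<in> S \<Longrightarrow> linear (L q)"
    and L: "\<And>u. ((\<lambda>q. L q u) has_derivative (\<lambda>h. L' h u)) (at p)" and L': "\<And>h. linear (L' h)"
    and w: "(w has_derivative w') (at p)"
  shows "((\<lambda>q. L q (w q)) has_derivative (\<lambda>h. L' h (w p) + L p (w' h))) (at p)"
proof -
  \<comment> \<open>Two basis vectors determine a linear map, so differentiability of
    \<open>L q u\<close> in \<open>q\<close> for each fixed \<open>u\<close> is enough for the
    product rule.\<close>
  have expand: "T u = fst u *\<^sub>R T (1, 0) + snd u *\<^sub>R T (0, 1)" if T: "linear T"
    for T :: "real \<times> real \<Rightarrow> 'b" and u
  proof -
    have "T u = T (fst u *\<^sub>R (1, 0) + snd u *\<^sub>R (0, 1))" by simp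
    then show ?thesis by (simp only: linear_add[OF T] linear_scale[OF T])
  qed
  have "((\<lambda>q. fst (w q) *\<^sub>R L q (1, 0) + snd (w q) *\<^sub>R L q (0, 1)) has_derivative
      (\<lambda>h. (fst (w p) *\<^sub>R L' h (1, 0) + fst (w' h) *\<^sub>R L p (1, 0))
        + (snd (w p) *\<^sub>R L' h (0, 1) + snd (w' h) *\<^sub>R L p (0, 1)))) (at p)"
    by (intro has_derivative_add has_derivative_scaleR has_derivative_fst has_derivative_snd w L)
  moreover have "(fst (w p) *\<^sub>R L' h (1, 0) + fst (w' h) *\<^sub>R L p (1, 0))
        + (snd (w p) *\<^sub>R L' h (0, 1) + snd (w' h) *\<^sub>R L p (0, 1)) = L' h (w p) + L p (w' h)" for h
    using expand[OF L', of h "w p"] expand[OF lin[OF assms(2)], of "w' h"] by (simp add: algebra_simps)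
  ultimately have d: "((\<lambda>q. fst (w q) *\<^sub>R L q (1, 0) + snd (w q) *\<^sub>R L q (0, 1)) has_derivative
      (\<lambda>h. L' h (w p) + L p (w' h))) (at p)"
    by simp
  show ?thesis
    by (rule has_derivative_transform_within_open[OF d assms(1,2)]) (rule expand[OF lin, symmetric])
qed

text \<open>Additivity and homogeneity hold identically for \<open>q\<close> near \<open>p\<close>,
  so both survive differentiation in the parameter.\<close>

lemma linear_frechet_derivative_family:
  fixes L :: "'a::euclidean_space \<Rightarrow> 'b::real_normed_vector \<Rightarrow> 'c::real_normed_vector"
  assumes "open S" "p \<in> S" and lin: "\<And>q. q \<in> S \<Longrightarrow> linear (L q)"
    and L: "\<And>u. (\<lambda>q. L q u) differentiable (at p)"
  shows "linear (\<lambda>u. frechet_derivative (\<lambda>q. L q u) (at p) h)"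
proof (rule linearI)
  have d: "((\<lambda>q. L q u) has_derivative frechet_derivative (\<lambda>q. L q u) (at p)) (at p)" for u
    using L frechet_derivative_works by blast
  fix u v
  have "((\<lambda>q. L q (u + v)) has_derivative (\<lambda>h. frechet_derivative (\<lambda>q. L q u) (at p) h
      + frechet_derivative (\<lambda>q. L q v) (at p) h)) (at p)"
    by (rule has_derivative_transform_within_open[OF has_derivative_add[OF d d] assms(1,2)])
      (simp add: linear_add[OF lin])
  from fun_cong[OF frechet_derivative_at[OF this], of h]
  show "frechet_derivative (\<lambda>q. L q (u + v)) (at p) h = frechet_derivative (\<lambda>q. L q u) (at p) h
      + frechet_derivative (\<lambda>q. L q v) (at p) h"
    by simp
next
  have d: "((\<lambda>q. L q u) has_derivative frechet_derivative (\<lambda>q. L q u) (at p)) (at p)" for u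
    using L frechet_derivative_works by blast
  fix c u
  have "((\<lambda>q. L q (c *\<^sub>R u)) has_derivative (\<lambda>h. c *\<^sub>R frechet_derivative (\<lambda>q. L q u) (at p) h)) (at p)"
    by (rule has_derivative_transform_within_open[OF has_derivative_scaleR_right[OF d] assms(1,2)])
      (simp add: linear_scale[OF lin])
  from fun_cong[OF frechet_derivative_at[OF this], of h]
  show "frechet_derivative (\<lambda>q. L q (c *\<^sub>R u)) (at p) h = c *\<^sub>R frechet_derivative (\<lambda>q. L q u) (at p) h"
    by simp
qed

lemma bilinear_minor:
  assumes "linear f" "linear f'" "linear g" "linear g'"
  shows "bilinear (\<lambda>u v. (n \<bullet> f u) *\<^sub>R g v - (n \<bullet> f' u) *\<^sub>R g' v)"
  using assms by (simp add: bilinear_def linear_iff algebra_simps)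

lemma bilinear_polarize:
  assumes B: "bilinear B" and "\<And>u. B u u = 0"
  shows "B u v + B v u = 0"
proof -
  have "B (u + v) (u + v) = B u u + B v v + (B u v + B v u)"
    by (simp add: bilinear_ladd[OF B] bilinear_radd[OF B] algebra_simps)
  then show ?thesis by (simp only: assms(2) add_0)
qed

text \<open>\<open>n\<close> represents a functional whose kernel is the plane. The inner product is
  the auxiliary one of the type class, not part of the Minkowski structure.\<close>

lemma range_linear_plane_eq_hyperplane:
  fixes T :: "real \<times> real \<Rightarrow> 'v::euclidean_space"
  assumes T: "linear T" "inj T" and dim: "DIM('v) = 3"
  obtains n where "n \<noteq> 0" "\<And>w. n \<bullet> w = 0 \<longleftrightarrow> w \<in> range T"
proof -
  have d: "dim (range T) = 2"
    using dim_image_eq[OF T(1), of UNIV] T(2) by (simp add: inj_on_subset)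
  have sub: "subspace (range T)"
    using linear_subspace_image[OF T(1)] by simp
  obtain n where n: "n \<noteq> 0" "span (range T) \<subseteq> {x. n \<bullet> x = 0}"
    using lowdim_subset_hyperplane[of "range T"] d dim by auto
  have "dim {x. n \<bullet> x = 0} = 2"
    using dim_hyperplane[OF n(1)] dim by simp
  moreover have "range T \<subseteq> {x. n \<bullet> x = 0}"
    using n(2) span_superset[of "range T"] by order
  ultimately have "range T = {x. n \<bullet> x = 0}"
    using subspace_dim_equal[OF sub subspace_hyperplane, of n] d by simp
  then show ?thesis using that[OF n(1)] by blast
qed

subsection \<open>Isometrically framed surfaces\<close>

text \<open>Only a field of linear isometries onto planes is kept; that these planes are tangent to
  an actual surface enters later through \<open>compatible\<close>.\<close>

locale framed_surface =
  target: minkowski_square G + plane: planar_minkowski_square F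
  for G :: "'v::euclidean_space \<Rightarrow> real" and F +
  fixes U :: "(real \<times> real) set" and E :: "real \<times> real \<Rightarrow> real \<times> real \<Rightarrow> 'v"
  assumes open_U: "open U" and dim: "DIM('v) = 3"
    and linear_E: "\<And>p. p \<in> U \<Longrightarrow> linear (E p)"
    and smooth_E: "\<And>u. Cn_on 2 U (\<lambda>p. E p u)"
    and isometric: "\<And>p u. p \<in> U \<Longrightarrow> G (E p u) = F u"
begin

definition E1 where "E1 h p u = frechet_derivative (\<lambda>q. E q u) (at p) h"
definition E2 where "E2 k h p u = frechet_derivative (\<lambda>q. E1 h q u) (at p) k"

lemma E_nonzero: "p \<in> U \<Longrightarrow> u \<noteq> 0 \<Longrightarrow> E p u \<noteq> 0"
  using isometric[of p u] plane.pos[of u] target.zero by auto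

lemma inj_E: "p \<in> U \<Longrightarrow> inj (E p)"
  using linear_injective_0[OF linear_E] E_nonzero by blast

lemma has_derivative_E: "p \<in> U \<Longrightarrow> ((\<lambda>q. E q u) has_derivative (\<lambda>h. E1 h p u)) (at p)"
  using Cn_on_2_D(1)[OF smooth_E] by (simp add: E1_def)

lemma has_derivative_E1: "p \<in> U \<Longrightarrow> ((\<lambda>q. E1 h q u) has_derivative (\<lambda>k. E2 k h p u)) (at p)"
  using Cn_on_2_D(2)[OF smooth_E] by (simp add: E1_def E2_def)

lemma linear_E1: "p \<in> U \<Longrightarrow> linear (E1 h p)"
  unfolding E1_def
  by (rule linear_frechet_derivative_family[OF open_U _ linear_E])
    (use has_derivative_E differentiable_def in blast)+

lemma linear_E2: "p \<in> U \<Longrightarrow> linear (E2 k h p)"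
  unfolding E2_def
  by (rule linear_frechet_derivative_family[OF open_U _ linear_E1])
    (use has_derivative_E1 differentiable_def in blast)+

lemma linear_E1_direction: "p \<in> U \<Longrightarrow> linear (\<lambda>h. E1 h p u)"
  using has_derivative_linear[OF has_derivative_E] .

lemma linear_E2_direction: "p \<in> U \<Longrightarrow> linear (\<lambda>k. E2 k h p u)"
  using has_derivative_linear[OF has_derivative_E1] .

lemma E2_commute: "p \<in> U \<Longrightarrow> E2 k h p u = E2 h k p u"
  unfolding E2_def E1_def by (rule mixed_derivative_commute[OF open_U _ smooth_E])

text \<open>Differentiate \<open>isometric\<close> in the frame vector with \<open>p\<close> fixed;
  \<open>D_E1\<close> below comes from differentiating it in \<open>p\<close> with \<open>u\<close>
  fixed.\<close>

lemma D_along_plane: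
  assumes "p \<in> U" "u \<noteq> 0"
  shows "target.D (E p u) (E p w) = plane.D u w"
proof -
  have "((\<lambda>v. G (E p v)) has_derivative (\<lambda>w. target.D (E p u) (E p w))) (at u)"
    by (rule has_derivative_compose[OF linear_imp_has_derivative[OF linear_E[OF assms(1)]]
          target.has_derivative[OF E_nonzero[OF assms]]])
  then have "(F has_derivative (\<lambda>w. target.D (E p u) (E p w))) (at u)"
    using isometric[OF assms(1)] by simp
  from has_derivative_unique[OF this plane.has_derivative[OF assms(2)]]
  show ?thesis by (rule fun_cong)
qed

lemma D_E1:
  assumes "p \<in> U" "u \<noteq> 0"
  shows "target.D (E p u) (E1 h p u) = 0"
proof -
  have "((\<lambda>q. G (E q u)) has_derivative (\<lambda>h. target.D (E p u) (E1 h p u))) (at p)"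
    by (rule has_derivative_compose[OF has_derivative_E[OF assms(1)]
          target.has_derivative[OF E_nonzero[OF assms]]])
  then have "((\<lambda>q. F u) has_derivative (\<lambda>h. target.D (E p u) (E1 h p u))) (at p)"
    by (rule has_derivative_transform_within_open[OF _ open_U assms(1)]) (simp add: isometric)
  then have "(\<lambda>h. target.D (E p u) (E1 h p u)) = (\<lambda>h. 0)"
    by (rule has_derivative_unique) simp
  then show ?thesis by meson
qed

text \<open>Differentiate the identity \<open>D_E1\<close> once more, along \<open>k\<close>. This
  is where the convexity of \<open>G\<close> becomes accessible.\<close>

lemma D_E2:
  assumes "p \<in> U" "u \<noteq> 0"
  shows "target.D (E p u) (E2 k h p u) = - second_differential G (E p u) (E1 h p u) (E1 k p u)"
proof -
  have "((\<lambda>q. target.D (E q u) (E1 h q u)) has_derivative (\<lambda>k. target.D (E p u) (E2 k h p u)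
      + second_differential G (E p u) (E1 h p u) (E1 k p u))) (at p)"
    by (rule target.has_derivative_D[OF E_nonzero[OF assms] has_derivative_E has_derivative_E1])
      (rule assms)+
  then have "((\<lambda>q. 0) has_derivative (\<lambda>k. target.D (E p u) (E2 k h p u)
      + second_differential G (E p u) (E1 h p u) (E1 k p u))) (at p)"
    by (rule has_derivative_transform_within_open[OF _ open_U assms(1)]) (simp add: D_E1 assms)
  then have "(\<lambda>k. target.D (E p u) (E2 k h p u)
      + second_differential G (E p u) (E1 h p u) (E1 k p u)) = (\<lambda>h. 0)"
    by (rule has_derivative_unique) simp
  then show ?thesis by (metis eq_neg_iff_add_eq_0)
qed

lemma plane_coordinates:
  assumes "p \<in> U"
  obtains g where "linear g" "\<And>w. w \<in> range (E p) \<Longrightarrow> E p (g w) = w"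
proof -
  obtain g where "linear g" "g \<circ> E p = id"
    using linear_injective_left_inverse[OF linear_E inj_E] assms by blast
  then show ?thesis
    by (intro that[of g]) (auto simp: fun_eq_iff)
qed

text \<open>A field without normal component pulls back through \<open>E p\<close> to the plane,
  where \<open>D_along_plane\<close> turns tangency to the level sets of \<open>G\<close> into
  tangency to those of \<open>F\<close>, and planar rigidity applies.\<close>

lemma tangent_linear_eq_0:
  assumes p: "p \<in> U" and n: "\<And>w. n \<bullet> w = 0 \<longleftrightarrow> w \<in> range (E p)"
    and W: "linear W" "\<And>u. n \<bullet> W u = 0" "\<And>u. u \<noteq> 0 \<Longrightarrow> target.D (E p u) (W u) = 0"
  shows "W u = 0"
proof -
  obtain g where g: "linear g" "\<And>w. w \<in> range (E p) \<Longrightarrow> E p (g w) = w"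
    using plane_coordinates[OF p] by blast
  have E_g: "E p (g (W u)) = W u" for u
    using g(2) W(2) n by blast
  have "g (W u) = 0"
  proof (rule plane.tangent_linear_eq_0[where A = "\<lambda>u. g (W u)"])
    show "linear (\<lambda>u. g (W u))" using linear_compose[OF W(1) g(1)] by (simp add: comp_def)
    show "plane.D u (g (W u)) = 0" if "u \<noteq> 0" for u
      using D_along_plane[OF p that, of "g (W u)"] W(3)[OF that] by (simp add: E_g)
  qed
  then show ?thesis using E_g[of u] linear_0[OF linear_E[OF p]] by simp
qed

lemma tangent_quadratic_eq_0:
  assumes p: "p \<in> U" and n: "\<And>w. n \<bullet> w = 0 \<longleftrightarrow> w \<in> range (E p)"
    and W: "bilinear W" "\<And>u. n \<bullet> W u u = 0" "\<And>u. u \<noteq> 0 \<Longrightarrow> target.D (E p u) (W u u) = 0"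
  shows "W u u = 0"
proof -
  obtain g where g: "linear g" "\<And>w. w \<in> range (E p) \<Longrightarrow> E p (g w) = w"
    using plane_coordinates[OF p] by blast
  have E_g: "E p (g (W u u)) = W u u" for u
    using g(2) W(2) n by blast
  have "g (W u u) = 0"
  proof (rule plane.tangent_quadratic_eq_0[where B = "\<lambda>u v. g (W u v)"])
    show "bilinear (\<lambda>u v. g (W u v))"
      using W(1) g(1) by (simp add: bilinear_def linear_iff)
    show "plane.D u (g (W u u)) = 0" if "u \<noteq> 0" for u
      using D_along_plane[OF p that, of "g (W u u)"] W(3)[OF that] by (simp add: E_g)
  qed
  then show ?thesis using E_g[of u] linear_0[OF linear_E[OF p]] by simp
qed

text \<open>\<open>u1\<close>, \<open>u2\<close> is the basis dual to the normal forms of the two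
  derivatives. One round of rigidity makes both derivatives multiples of a single vector
  \<open>m\<close>; a second round, on second derivatives modulo \<open>m\<close>, contradicts
  convexity in direction \<open>m\<close>.\<close>

lemma normal_forms_not_independent:
  assumes p: "p \<in> U" and n: "\<And>w. n \<bullet> w = 0 \<longleftrightarrow> w \<in> range (E p)"
    and u1: "n \<bullet> E1 h p u1 = 1" "n \<bullet> E1 k p u1 = 0"
    and u2: "n \<bullet> E1 h p u2 = 0" "n \<bullet> E1 k p u2 = 1"
  shows False
proof -
  note lin = linear_E1[OF p] linear_E2[OF p]
  let ?D = "\<lambda>u. target.D (E p u)"
  have linD: "linear (?D u)" if "u \<noteq> 0" for u
    using target.linear_D[OF E_nonzero[OF p that]] .
  note D_simps = linear_diff[OF linD] linear_scale[OF linD]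
  \<comment> \<open>On the diagonal the normal components cancel, so quadratic rigidity
    applies.\<close>
  define B where "B = (\<lambda>u v. (n \<bullet> E1 h p u) *\<^sub>R E1 k p v - (n \<bullet> E1 k p u) *\<^sub>R E1 h p v)"
  have B: "bilinear B" unfolding B_def by (intro bilinear_minor lin)
  have B_diag: "B u u = 0" for u
    by (rule tangent_quadratic_eq_0[OF p n B])
      (simp_all add: B_def inner_diff_right D_simps D_E1[OF p])
  define m where "m = E1 h p u1"
  have nm: "n \<bullet> m = 1" by (simp add: m_def u1)
  have "E1 k p u1 = 0" using B_diag[of u1] by (simp add: B_def u1)
  \<comment> \<open>Polarizing at \<open>u1\<close> isolates \<open>E1 k p u\<close>, because the
    normal forms take the values 1 and 0 there.\<close>
  then have Ek: "E1 k p u = (n \<bullet> E1 k p u) *\<^sub>R m" for u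
    using bilinear_polarize[OF B B_diag, of u u1] by (simp add: B_def u1 m_def algebra_simps)
  have "E1 h p u2 = 0" using B_diag[of u2] by (simp add: B_def u2)
  moreover have "E1 k p u2 = m" using Ek[of u2] by (simp add: u2)
  ultimately have Eh: "E1 h p u = (n \<bullet> E1 h p u) *\<^sub>R m" for u
    using bilinear_polarize[OF B B_diag, of u u2] by (simp add: B_def u2 nm algebra_simps)
  \<comment> \<open>Wherever a normal form is nonzero, \<open>m\<close> itself is tangent to the
    level set; the product form avoids division.\<close>
  have D_m: "(n \<bullet> E1 h p u) * ?D u m = 0" "(n \<bullet> E1 k p u) * ?D u m = 0" if "u \<noteq> 0" for u
    using D_E1[OF p that, of h] D_E1[OF p that, of k] Eh[of u] Ek[of u] linear_scale[OF linD[OF that], of _ m]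
    by (metis real_scaleR_def)+
  define H where "H u = second_differential G (E p u) m m" for u
  have sd: "second_differential G (E p u) (a *\<^sub>R m) (b *\<^sub>R m) = a * b * H u" if "u \<noteq> 0" for u a b
    by (simp add: H_def linear_scale[OF target.linear_sd(1)[OF E_nonzero[OF p that]]]
        linear_scale[OF target.linear_sd(2)[OF E_nonzero[OF p that]]])
  have D_second: "?D u (E2 k' h' p u) = - (a * b * H u)"
    if "u \<noteq> 0" "E1 h' p u = a *\<^sub>R m" "E1 k' p u = b *\<^sub>R m" for u h' k' a b
    using D_E2[OF p that(1), of k' h'] sd[OF that(1), of a b] by (simp add: that(2,3))
  note D_hh = D_second[OF _ Eh Eh] and D_kh = D_second[OF _ Eh Ek] and D_kk = D_second[OF _ Ek Ek]
  \<comment> \<open>Subtracting the multiple of \<open>m\<close> with the same normal component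
    leaves a vector in the plane.\<close>
  define X where "X k h u = E2 k h p u - (n \<bullet> E2 k h p u) *\<^sub>R m" for k h u
  have linX: "linear (X k h)" for k h
    using lin(2)[of k h] by (simp add: X_def linear_iff algebra_simps)
  have nX: "n \<bullet> X k h u = 0" for k h u
    by (simp add: X_def inner_diff_right nm)
  \<comment> \<open>The coefficients are crossed so that the terms with \<open>H\<close> from
    \<open>D_E2\<close> cancel on the diagonal; the terms with \<open>m\<close> vanish by
    \<open>D_m\<close>.\<close>
  define B1 where "B1 = (\<lambda>u v. (n \<bullet> E1 k p u) *\<^sub>R X h h v - (n \<bullet> E1 h p u) *\<^sub>R X k h v)"
  have B1: "bilinear B1" unfolding B1_def by (intro bilinear_minor lin linX)
  have B1_diag: "B1 u u = 0" for u
  proof (rule tangent_quadratic_eq_0[OF p n B1])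
    show "n \<bullet> B1 u u = 0" for u by (simp add: B1_def inner_diff_right nX)
    show "?D u (B1 u u) = 0" if u: "u \<noteq> 0" for u
      using D_m[OF u] D_hh[OF u] D_kh[OF u] by (auto simp: B1_def X_def D_simps[OF u])
  qed
  define B2 where "B2 = (\<lambda>u v. (n \<bullet> E1 k p u) *\<^sub>R X k h v - (n \<bullet> E1 h p u) *\<^sub>R X k k v)"
  have B2: "bilinear B2" unfolding B2_def by (intro bilinear_minor lin linX)
  have B2_diag: "B2 u u = 0" for u
  proof (rule tangent_quadratic_eq_0[OF p n B2])
    show "n \<bullet> B2 u u = 0" for u by (simp add: B2_def inner_diff_right nX)
    show "?D u (B2 u u) = 0" if u: "u \<noteq> 0" for u
      using D_m[OF u] D_kk[OF u] D_kh[OF u] by (auto simp: B2_def X_def D_simps[OF u])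
  qed
  \<comment> \<open>Evaluation on the dual basis leaves one term of each field: \<open>B1\<close>
    polarized links the two values, and \<open>B2\<close> at \<open>u2\<close> shows that they
    vanish.\<close>
  have "X h h u1 = X k h u2"
    using bilinear_polarize[OF B1 B1_diag, of u1 u2] by (simp add: B1_def u1 u2)
  also have "\<dots> = 0" using B2_diag[of u2] by (simp add: B2_def u2)
  finally have e: "E2 h h p u1 = (n \<bullet> E2 h h p u1) *\<^sub>R m" by (simp add: X_def)
  have u1_nz: "u1 \<noteq> 0"
    using u1(1) linear_0[OF lin(1)[of h]] by auto
  \<comment> \<open>At \<open>u1\<close> the second derivative along \<open>h\<close> is a multiple
    of the tangent vector \<open>m\<close>, so its \<open>D\<close>-value is 0, while
    \<open>D_hh\<close> makes it \<open>- H u1\<close>.\<close>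
  have "?D u1 m = 0" using D_m(1)[OF u1_nz] u1(1) by simp
  then have "?D u1 (E2 h h p u1) = 0"
    using e linear_scale[OF linD[OF u1_nz], of _ m] by (metis mult_zero_right real_scaleR_def)
  then have "H u1 = 0" using D_hh[OF u1_nz] u1(1) by simp
  moreover have "m \<noteq> 0" using nm by auto
  ultimately show False
    using target.convex[OF E_nonzero[OF p u1_nz], of m] by (simp add: H_def)
qed

text \<open>The normal forms are dependent, so some combination of the derivatives has no normal
  component; being tangent to the level sets, it vanishes by linear rigidity.\<close>

lemma frame_derivatives_dependent:
  assumes p: "p \<in> U"
  obtains s t where "(s, t) \<noteq> (0, 0)" "\<And>u. s *\<^sub>R E1 h p u + t *\<^sub>R E1 k p u = 0"
proof -
  note lin = linear_E1[OF p]
  obtain n where n: "\<And>w. n \<bullet> w = 0 \<longleftrightarrow> w \<in> range (E p)"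
    using range_linear_plane_eq_hyperplane[OF linear_E[OF p] inj_E[OF p] dim] by metis
  define a b c d where "a = n \<bullet> E1 h p (1, 0)" and "b = n \<bullet> E1 h p (0, 1)"
    and "c = n \<bullet> E1 k p (1, 0)" and "d = n \<bullet> E1 k p (0, 1)"
  have expand: "E1 h p (x, y) = x *\<^sub>R E1 h p (1, 0) + y *\<^sub>R E1 h p (0, 1)" for h x y
  proof -
    have "E1 h p (x, y) = E1 h p (x *\<^sub>R (1, 0) + y *\<^sub>R (0, 1))" by simp
    then show ?thesis by (simp only: linear_add[OF lin] linear_scale[OF lin])
  qed
  have n_h: "n \<bullet> E1 h p (x, y) = a * x + b * y" and n_k: "n \<bullet> E1 k p (x, y) = c * x + d * y" for x y
    using expand[of h x y] expand[of k x y] by (simp_all add: a_def b_def c_def d_def inner_add_right)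
  have det: "a * d - b * c = 0"
  proof (rule ccontr)
    assume "a * d - b * c \<noteq> 0"
    \<comment> \<open>The witnesses are the columns of the inverse of the matrix with rows
      \<open>(a, b)\<close> and \<open>(c, d)\<close>.\<close>
    then show False
      by (intro normal_forms_not_independent[OF p n, of h "(d / (a * d - b * c), - c / (a * d - b * c))" k
            "(- b / (a * d - b * c), a / (a * d - b * c))"])
        (simp_all add: n_h n_k diff_divide_distrib[symmetric] add_divide_distrib[symmetric] algebra_simps)
  qed
  obtain s t where st: "(s, t) \<noteq> (0, 0)" "s * a + t * c = 0" "s * b + t * d = 0"
  proof (cases "(c, a) = (0, 0)")
    case False
    then show ?thesis using det by (intro that[of c "- a"]) (auto simp: algebra_simps)
  next
    case ac: True
    show ?thesis
    proof (cases "(d, b) = (0, 0)")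
      case False
      then show ?thesis using ac by (intro that[of d "- b"]) (auto simp: algebra_simps)
    next
      case True
      then show ?thesis using ac by (intro that[of 1 0]) auto
    qed
  qed
  have "s *\<^sub>R E1 h p u + t *\<^sub>R E1 k p u = 0" for u
  proof (rule tangent_linear_eq_0[OF p n])
    show "linear (\<lambda>u. s *\<^sub>R E1 h p u + t *\<^sub>R E1 k p u)"
      using lin[of h] lin[of k] by (simp add: linear_iff algebra_simps)
    show "n \<bullet> (s *\<^sub>R E1 h p u + t *\<^sub>R E1 k p u) = 0" for u
    proof -
      obtain x y where u: "u = (x, y)" by fastforce
      have "s * (a * x + b * y) + t * (c * x + d * y) = (s * a + t * c) * x + (s * b + t * d) * y"
        by (simp add: algebra_simps)
      then show ?thesis by (simp add: u inner_add_right n_h n_k st)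
    qed
    show "target.D (E p u) (s *\<^sub>R E1 h p u + t *\<^sub>R E1 k p u) = 0" if "u \<noteq> 0" for u
      using linear_add[OF target.linear_D[OF E_nonzero[OF p that]]]
        linear_scale[OF target.linear_D[OF E_nonzero[OF p that]]]
      by (simp add: D_E1[OF p that])
  qed
  then show ?thesis using that st(1) by blast
qed

end

lemma plane_dependent_cases:
  fixes x y :: "real \<times> real"
  assumes "x \<noteq> 0"
  obtains c where "y = c *\<^sub>R x" | "\<And>u. \<exists>a b. u = a *\<^sub>R x + b *\<^sub>R y"
proof -
  obtain x1 x2 where x: "x = (x1, x2)" by fastforce
  obtain y1 y2 where y: "y = (y1, y2)" by fastforce
  show ?thesis
  proof (cases "x1 * y2 - x2 * y1 = 0")
    case True
    have pos: "x1 * x1 + x2 * x2 \<noteq> 0"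
      using assms by (auto simp: x zero_prod_def sum_squares_eq_zero_iff)
    have "(x1 * x1 + x2 * x2) *\<^sub>R y = (x1 * y1 + x2 * y2) *\<^sub>R x"
      using True by (simp add: x y) algebra
    then have "y = ((x1 * y1 + x2 * y2) / (x1 * x1 + x2 * x2)) *\<^sub>R x"
      using pos by (metis divide_inverse_commute scaleR_cancel_left scaleR_scaleR mult_scaleR_left
          nonzero_mult_div_cancel_left times_divide_eq_right)
    then show ?thesis by (rule that(1))
  next
    case False
    show ?thesis
    proof (rule that(2))
      fix u :: "real \<times> real"
      obtain u1 u2 where u: "u = (u1, u2)" by fastforce
      define d where "d = x1 * y2 - x2 * y1"
      have "u = ((u1 * y2 - u2 * y1) / d) *\<^sub>R x + ((x1 * u2 - x2 * u1) / d) *\<^sub>R y"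
        using False unfolding d_def[symmetric]
        by (simp add: x y u add_divide_distrib[symmetric]) (simp add: d_def field_simps)
      then show "\<exists>a b. u = a *\<^sub>R x + b *\<^sub>R y" by blast
    qed
  qed
qed

subsection \<open>Rotating frames\<close>

text \<open>\<open>radial y\<close> and \<open>angular y\<close> are the images of
  \<open>(1, 0)\<close> and \<open>(0, 1)\<close> under \<open>rotation y\<close>.\<close>

definition radial :: "real \<Rightarrow> real \<times> real" where "radial y = (cos y, sin y)"
definition angular :: "real \<Rightarrow> real \<times> real" where "angular y = (- sin y, cos y)"

lemma radial_nonzero: "radial y \<noteq> 0"
  using sin_zero_abs_cos_one[of y] by (auto simp: radial_def zero_prod_def)

lemma angular_nonzero: "angular y \<noteq> 0"
  using sin_zero_abs_cos_one[of y] by (auto simp: angular_def zero_prod_def)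

lemma inner_angular: "angular y \<bullet> angular y = 1" "radial y \<bullet> angular y = 0"
  using sin_cos_squared_add3[of y] by (auto simp: radial_def angular_def algebra_simps)

lemma has_derivative_radial:
  assumes "(g has_derivative g') (at p)"
  shows "((\<lambda>q. radial (g q)) has_derivative (\<lambda>h. g' h *\<^sub>R angular (g p))) (at p)"
  unfolding radial_def angular_def
  by (rule has_derivative_eq_rhs[OF has_derivative_Pair[OF has_derivative_cos[OF assms]
        has_derivative_sin[OF assms]]]) (simp add: fun_eq_iff)

lemma has_derivative_angular:
  assumes "(g has_derivative g') (at p)"
  shows "((\<lambda>q. angular (g q)) has_derivative (\<lambda>h. - g' h *\<^sub>R radial (g p))) (at p)"
  unfolding radial_def angular_def
  by (rule has_derivative_eq_rhs[OF has_derivative_Pair[OF has_derivative_minus[OF has_derivative_sin[OF assms]]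
        has_derivative_cos[OF assms]]]) (simp add: fun_eq_iff)

text \<open>With \<open>E p = d\<^sub>p f \<circ> R\<^sup>-\<^sup>y\<close>, the vectors
  \<open>E p (radial y)\<close> and \<open>E p (angular y)\<close> are the partial derivatives of
  \<open>f\<close> in \<open>x\<close> and \<open>y\<close>; \<open>compatible\<close> is the
  equality of the mixed second partials.\<close>

locale rotating_frame = framed_surface +
  assumes compatible: "\<And>p. p \<in> U \<Longrightarrow>
    E1 (0, 1) p (radial (snd p)) + E p (angular (snd p)) = E1 (1, 0) p (angular (snd p))"
begin

text \<open>If the horizontal derivative \<open>?X\<close> were nonzero, dependence would give a
  ruling direction \<open>k\<close> along which the frame is stationary. Differentiating the
  compatibility relation along \<open>k\<close> shows that \<open>?X\<close> has no normal
  component, so it vanishes by rigidity.\<close>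

lemma E1_horizontal_eq_0:
  assumes p: "p \<in> U"
  shows "E1 (1, 0) p l = 0"
proof (rule ccontr)
  assume l: "E1 (1, 0) p l \<noteq> 0"
  let ?X = "E1 (1, 0)" and ?Y = "E1 (0, 1)"
  let ?r = "\<lambda>q. radial (snd q)" and ?a = "\<lambda>q. angular (snd q)"
  have "continuous_on U (\<lambda>q. ?X q l)"
    by (intro continuous_at_imp_continuous_on ballI has_derivative_continuous[OF has_derivative_E1])
  then have "open (U \<inter> (\<lambda>q. ?X q l) -` (- {0}))"
    using continuous_open_preimage[OF _ open_U] by blast
  moreover define N where "N = U \<inter> (\<lambda>q. ?X q l) -` (- {0})"
  ultimately have N: "open N" "p \<in> N" "N \<subseteq> U" "\<And>q. q \<in> N \<Longrightarrow> ?X q l \<noteq> 0"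
    using p l by auto
  \<comment> \<open>The proportionality factor is read off at the single vector \<open>l\<close>,
    which makes it a differentiable function of \<open>q\<close>; \<open>Y_eq\<close> shows that it
    serves every \<open>u\<close>.\<close>
  define \<sigma> where "\<sigma> q = - (?Y q l \<bullet> ?X q l) / (?X q l \<bullet> ?X q l)" for q
  have Y_eq: "?Y q u = - \<sigma> q *\<^sub>R ?X q u" if q: "q \<in> N" for q u
  proof -
    obtain s t where st: "(s, t) \<noteq> (0, 0)" "\<And>u. s *\<^sub>R ?X q u + t *\<^sub>R ?Y q u = 0"
      using frame_derivatives_dependent[of q "(1, 0)" "(0, 1)"] q N(3) by blast
    have t: "t \<noteq> 0" using st(1) st(2)[of l] N(4)[OF q] by auto
    have Y: "?Y q u = - (s / t) *\<^sub>R ?X q u" for u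
    proof -
      have "t *\<^sub>R ?Y q u = t *\<^sub>R (- (s / t) *\<^sub>R ?X q u)"
        using st(2)[of u] t by (simp add: add_eq_0_iff)
      then show ?thesis using t by (simp only: scaleR_cancel_left) simp
    qed
    have "\<sigma> q = s / t"
      using N(4)[OF q] by (simp add: \<sigma>_def Y[of l])
    then show ?thesis using Y by simp
  qed
  define \<kappa> where "\<kappa> q = \<sigma> q *\<^sub>R ?r q + ?a q" for q
  have \<kappa>_nz: "\<kappa> q \<noteq> 0" for q
  proof
    assume "\<kappa> q = 0"
    then have "\<kappa> q \<bullet> ?a q = 0" by simp
    then show False by (simp add: \<kappa>_def inner_add_left inner_angular)
  qed
  \<comment> \<open>This is \<open>compatible\<close> with \<open>?Y\<close> replaced by
    \<open>- \<sigma> q *\<^sub>R ?X q\<close>.\<close>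
  have X_\<kappa>: "?X q (\<kappa> q) = E q (?a q)" if q: "q \<in> N" for q
  proof -
    have "q \<in> U" using q N(3) by auto
    then show ?thesis
      using compatible[of q] linear_add[OF linear_E1] linear_scale[OF linear_E1]
      by (simp add: \<kappa>_def Y_eq[OF q] algebra_simps)
  qed
  have D_\<kappa>: "plane.D (\<kappa> q) (?a q) = 0" if q: "q \<in> N" for q
  proof -
    have "q \<in> U" using q N(3) by auto
    then show ?thesis
      using D_along_plane[OF _ \<kappa>_nz[of q], of q "?a q"] D_E1[OF _ \<kappa>_nz[of q], of q "(1, 0)"] X_\<kappa>[OF q] by simp
  qed
  have "\<exists>\<sigma>'. (\<sigma> has_derivative \<sigma>') (at p)"
    unfolding \<sigma>_def using l
    by (intro exI) (rule has_derivative_divide has_derivative_minus has_derivative_inner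
        has_derivative_E1 p | simp)+
  then obtain \<sigma>' where \<sigma>': "(\<sigma> has_derivative \<sigma>') (at p)" by blast
  define \<kappa>' where "\<kappa>' h = \<sigma> p *\<^sub>R (snd h *\<^sub>R ?a p) + \<sigma>' h *\<^sub>R ?r p - snd h *\<^sub>R ?r p" for h
  have snd': "(snd has_derivative snd) (at p)"
    by (rule bounded_linear_imp_has_derivative[OF bounded_linear_snd])
  have a': "((\<lambda>q. ?a q) has_derivative (\<lambda>h. - snd h *\<^sub>R ?r p)) (at p)"
    using has_derivative_angular[OF snd'] .
  have \<kappa>': "(\<kappa> has_derivative \<kappa>') (at p)"
    unfolding \<kappa>_def \<kappa>'_def
    by (rule has_derivative_eq_rhs[OF has_derivative_add[OF
          has_derivative_scaleR[OF \<sigma>' has_derivative_radial[OF snd']] a']]) (simp add: fun_eq_iff)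
  let ?sd = "second_differential F (\<kappa> p) (?a p)"
  have tangency: "plane.D (\<kappa> p) (- snd h *\<^sub>R ?r p) + ?sd (\<kappa>' h) = 0" for h
  proof -
    have "((\<lambda>q. 0) has_derivative (\<lambda>h. plane.D (\<kappa> p) (- snd h *\<^sub>R ?r p) + ?sd (\<kappa>' h))) (at p)"
      by (rule has_derivative_transform_within_open[OF plane.has_derivative_D[OF \<kappa>_nz \<kappa>' a'] N(1,2)])
        (simp add: D_\<kappa>)
    then have "(\<lambda>h. plane.D (\<kappa> p) (- snd h *\<^sub>R ?r p) + ?sd (\<kappa>' h)) = (\<lambda>h. 0)"
      by (rule has_derivative_unique) simp
    then show ?thesis by (rule fun_cong)
  qed
  note lin_sd = plane.linear_sd(2)[OF \<kappa>_nz[of p], of "?a p"] and linD = plane.linear_D[OF \<kappa>_nz[of p]]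
  \<comment> \<open>Since \<open>\<kappa> p\<close> is
    \<open>\<sigma> p *\<^sub>R ?r p + ?a p\<close> and convexity makes \<open>?sd (?a p)\<close>
    positive, vanishing at \<open>\<kappa> p\<close> forces \<open>?sd (?r p)\<close> to be
    nonzero.\<close>
  have radial_sd: "?sd (\<kappa> p) = 0"
    using plane.sd_radial[OF \<kappa>_nz[of p], of "?a p"] D_\<kappa>[OF N(2)] by simp
  have "?sd (?a p) > 0"
    by (rule plane.convex[OF \<kappa>_nz angular_nonzero])
  moreover have "\<sigma> p * ?sd (?r p) + ?sd (?a p) = 0"
    using radial_sd linear_add[OF lin_sd, of "\<sigma> p *\<^sub>R ?r p" "?a p"]
    by (simp add: linear_scale[OF lin_sd] \<kappa>_def[of p, symmetric])
  ultimately have "?sd (?r p) \<noteq> 0" by auto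
  \<comment> \<open>A horizontal move leaves the angle unchanged, so \<open>tangency\<close> reduces
    to \<open>\<sigma>' (1, 0)\<close> times the nonzero number \<open>?sd (?r p)\<close>.\<close>
  then have \<sigma>x: "\<sigma>' (1, 0) = 0"
    using tangency[of "(1, 0)"] by (simp add: \<kappa>'_def linear_scale[OF lin_sd] linear_0[OF linD])
  \<comment> \<open>The ruling direction: \<open>E1\<close> vanishes along it, as \<open>?Y\<close>
    is \<open>- \<sigma> p\<close> times \<open>?X\<close>.\<close>
  define k where "k = (\<sigma> p, 1 :: real)"
  have k: "k = \<sigma> p *\<^sub>R (1, 0) + (0, 1)" and snd_k: "snd k = 1" by (simp_all add: k_def)
  note lin_dir = linear_E1_direction[OF p] linear_E2_direction[OF p]
  have E1_k: "E1 k p u = 0" for u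
    by (simp only: k linear_add[OF lin_dir(1)] linear_scale[OF lin_dir(1)] Y_eq[OF N(2)]) simp
  have "E2 (1, 0) (0, 1) p u = - \<sigma> p *\<^sub>R E2 (1, 0) (1, 0) p u" for u
  proof -
    have "((\<lambda>q. - \<sigma> q *\<^sub>R ?X q u) has_derivative
        (\<lambda>h. - \<sigma> p *\<^sub>R E2 h (1, 0) p u + - \<sigma>' h *\<^sub>R ?X p u)) (at p)"
      by (intro has_derivative_scaleR has_derivative_minus \<sigma>' has_derivative_E1 p)
    then have "((\<lambda>q. ?Y q u) has_derivative
        (\<lambda>h. - \<sigma> p *\<^sub>R E2 h (1, 0) p u + - \<sigma>' h *\<^sub>R ?X p u)) (at p)"
      by (rule has_derivative_transform_within_open[OF _ N(1,2)]) (simp add: Y_eq)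
    from fun_cong[OF has_derivative_unique[OF has_derivative_E1[OF p] this], of "(1, 0)"]
    show ?thesis by (simp add: \<sigma>x)
  qed
  \<comment> \<open>Because \<open>\<sigma>\<close> has no horizontal derivative, symmetry of second
    derivatives makes \<open>?X\<close> stationary along \<open>k\<close> as well.\<close>
  then have E2_k: "E2 k (1, 0) p u = 0" for u
    using E2_commute[OF p, of "(0, 1)" "(1, 0)"]
    by (simp only: k linear_add[OF lin_dir(2)] linear_scale[OF lin_dir(2)]) simp
  have "((\<lambda>q. ?X q (\<kappa> q)) has_derivative (\<lambda>h. E2 h (1, 0) p (\<kappa> p) + ?X p (\<kappa>' h))) (at p)"
    by (rule has_derivative_linear_apply[OF open_U p linear_E1 has_derivative_E1[OF p] linear_E2[OF p] \<kappa>'])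
  then have "((\<lambda>q. E q (?a q)) has_derivative (\<lambda>h. E2 h (1, 0) p (\<kappa> p) + ?X p (\<kappa>' h))) (at p)"
    by (rule has_derivative_transform_within_open[OF _ N(1,2)]) (simp add: X_\<kappa>)
  moreover have "((\<lambda>q. E q (?a q)) has_derivative (\<lambda>h. E1 h p (?a p) + E p (- snd h *\<^sub>R ?r p))) (at p)"
    by (rule has_derivative_linear_apply[OF open_U p linear_E has_derivative_E[OF p] linear_E1[OF p] a'])
  ultimately have "(\<lambda>h. E2 h (1, 0) p (\<kappa> p) + ?X p (\<kappa>' h))
      = (\<lambda>h. E1 h p (?a p) + E p (- snd h *\<^sub>R ?r p))"
    by (rule has_derivative_unique)
  from fun_cong[OF this, of k]
  \<comment> \<open>Along \<open>k\<close> the terms in which \<open>?X\<close> or \<open>E\<close>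
    is differentiated drop out, leaving only the motion of the vectors.\<close>
  have X_\<kappa>': "?X p (\<kappa>' k) = E p (- ?r p)"
    by (simp add: E1_k E2_k snd_k)
  obtain n where n: "\<And>w. n \<bullet> w = 0 \<longleftrightarrow> w \<in> range (E p)"
    using range_linear_plane_eq_hyperplane[OF linear_E[OF p] inj_E[OF p] dim] by metis
  have n0: "n \<bullet> ?X p (\<kappa> p) = 0" "n \<bullet> ?X p (\<kappa>' k) = 0"
    using n by (auto simp: X_\<kappa>[OF N(2)] X_\<kappa>')
  show False
  proof (rule plane_dependent_cases[OF \<kappa>_nz])
    \<comment> \<open>Here \<open>tangency\<close> makes \<open>?r p\<close> tangent at
      \<open>\<kappa> p\<close>. As \<open>?a p\<close> is tangent there too, so is
      \<open>\<kappa> p\<close> itself, against Euler's identity.\<close>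
    fix c assume c: "\<kappa>' k = c *\<^sub>R \<kappa> p"
    have "plane.D (\<kappa> p) (?r p) = 0"
      using tangency[of k] linear_scale[OF linD, of "-1" "?r p"]
      by (simp add: c linear_scale[OF lin_sd] radial_sd snd_k)
    then have "plane.D (\<kappa> p) (\<kappa> p) = 0"
      using D_\<kappa>[OF N(2)] linear_add[OF linD, of "\<sigma> p *\<^sub>R ?r p" "?a p"] linear_scale[OF linD, of "\<sigma> p" "?r p"]
      by (simp add: \<kappa>_def)
    then show False
      using plane.euler[OF \<kappa>_nz[of p]] plane.pos[OF \<kappa>_nz[of p]] by simp
  next
    assume span: "\<And>u. \<exists>a b. u = a *\<^sub>R \<kappa> p + b *\<^sub>R \<kappa>' k"
    have "n \<bullet> ?X p u = 0" for u
    proof -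
      obtain a b where "u = a *\<^sub>R \<kappa> p + b *\<^sub>R \<kappa>' k" using span by blast
      then show ?thesis
        by (simp add: linear_add[OF linear_E1[OF p]] linear_scale[OF linear_E1[OF p]] inner_add_right n0)
    qed
    from tangent_linear_eq_0[OF p n linear_E1[OF p] this D_E1[OF p]]
    show False using l by blast
  qed
qed

text \<open>Without the horizontal derivative, \<open>compatible\<close> identifies
  \<open>E p (angular y)\<close> with minus a frame derivative at \<open>radial y\<close>, which is
  tangent by \<open>D_E1\<close>.\<close>

lemma D_radial_angular:
  assumes p: "p \<in> U"
  shows "plane.D (radial (snd p)) (angular (snd p)) = 0"
proof -
  let ?r = "radial (snd p)"
  have "E p (angular (snd p)) = - E1 (0, 1) p ?r"
    using compatible[OF p] E1_horizontal_eq_0[OF p] by (simp add: eq_neg_iff_add_eq_0 add.commute)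
  then have "target.D (E p ?r) (E p (angular (snd p))) = - target.D (E p ?r) (E1 (0, 1) p ?r)"
    using linear_neg[OF target.linear_D[OF E_nonzero[OF p radial_nonzero]]] by simp
  then show ?thesis
    using D_along_plane[OF p radial_nonzero] D_E1[OF p radial_nonzero] by simp
qed

end

text \<open>The hypothesis says that \<open>F\<close> has zero derivative along an arc of the unit
  circle; homogeneity spreads the constant value over a cone.\<close>

lemma (in planar_minkowski_square) eq_norm_square_on_sector:
  assumes "\<epsilon> > 0" and tangent: "\<And>y. \<bar>y - c\<bar> < \<epsilon> \<Longrightarrow> D (radial y) (angular y) = 0"
  shows "\<exists>W C. open W \<and> W \<noteq> {} \<and> C > 0 \<and> (\<forall>v\<in>W. F v = C * (norm v)\<^sup>2)"
proof -
  define C where "C = F (radial c)"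
  have radial_const: "F (radial y) = C" if "\<bar>y - c\<bar> < \<epsilon>" for y
  proof -
    have "((\<lambda>y. F (radial y)) has_derivative (\<lambda>h. 0)) (at y)" if y: "y \<in> {c - \<epsilon><..<c + \<epsilon>}" for y
    proof -
      have "((\<lambda>y. F (radial y)) has_derivative (\<lambda>h. D (radial y) (h *\<^sub>R angular y))) (at y)"
        by (rule has_derivative_compose[OF has_derivative_radial[OF has_derivative_ident]
              has_derivative[OF radial_nonzero]])
      moreover have "D (radial y) (h *\<^sub>R angular y) = 0" for h
      proof -
        have "\<bar>y - c\<bar> < \<epsilon>" using y by (auto simp: abs_less_iff)
        then show ?thesis
          using tangent[of y] by (simp add: linear_scale[OF linear_D[OF radial_nonzero]])
      qed
      ultimately show ?thesis by simp
    qed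
    from has_derivative_zero_unique_connected[OF _ _ this, of "{c - \<epsilon><..<c + \<epsilon>}" y c]
    show ?thesis using that \<open>\<epsilon> > 0\<close> by (auto simp: C_def abs_less_iff)
  qed
  \<comment> \<open>In the coordinates \<open>a\<close>, \<open>b\<close> along
    \<open>radial c\<close> and \<open>angular c\<close>, this open cone stays within angle
    \<open>\<epsilon>\<close> of \<open>radial c\<close>, since
    \<open>\<bar>arctan (b / a)\<bar> \<le> \<bar>b / a\<bar>\<close>.\<close>
  define W where "W = {v :: real \<times> real. \<bar>v \<bullet> angular c\<bar> < \<epsilon> * (v \<bullet> radial c)}"
  have "open W"
    unfolding W_def by (intro open_Collect_less continuous_intros)
  moreover have "radial c \<in> W"
    using \<open>\<epsilon> > 0\<close> sin_cos_squared_add3[of c] by (auto simp: W_def radial_def angular_def algebra_simps)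
  moreover have "C > 0"
    by (simp add: C_def pos[OF radial_nonzero])
  moreover have "F v = C * (norm v)\<^sup>2" if v: "v \<in> W" for v
  proof -
    define a b where "a = v \<bullet> radial c" and "b = v \<bullet> angular c"
    have ab: "\<bar>b\<bar> < \<epsilon> * a" using v by (simp add: W_def a_def b_def)
    then have "0 < \<epsilon> * a" by linarith
    then have a: "a > 0" using \<open>\<epsilon> > 0\<close> by (simp add: zero_less_mult_iff)
    define t where "t = arctan (b / a)"
    have "\<bar>t\<bar> \<le> \<bar>b / a\<bar>"
      unfolding t_def by (rule abs_arctan_le)
    also have "\<dots> < \<epsilon>" using ab a by (simp add: abs_divide pos_divide_less_eq)
    finally have t: "\<bar>(c + t) - c\<bar> < \<epsilon>" by simp
    have cs: "cos t > 0" "sin t * a = cos t * b"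
    proof -
      show ct: "cos t > 0" unfolding t_def using cos_gt_zero_pi arctan_lbound arctan_ubound by simp
      have "tan t = b / a" by (simp add: t_def tan_arctan)
      then show "sin t * a = cos t * b" using a ct by (simp add: tan_def field_simps)
    qed
    define \<rho> where "\<rho> = a / cos t"
    have \<rho>: "\<rho> > 0" using a cs by (simp add: \<rho>_def)
    have \<rho>ab: "\<rho> * cos t = a" "\<rho> * sin t = b"
      using cs a by (simp_all add: \<rho>_def field_simps)
    have "v = a *\<^sub>R radial c + b *\<^sub>R angular c"
    proof -
      obtain v1 v2 where v12: "v = (v1, v2)" by fastforce
      have "cos c * cos c + sin c * sin c = 1" by simp
      then have "v1 = (v1 * cos c + v2 * sin c) * cos c - (v2 * cos c - v1 * sin c) * sin c"
        "v2 = (v1 * cos c + v2 * sin c) * sin c + (v2 * cos c - v1 * sin c) * cos c"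
        by algebra+
      then show ?thesis by (simp add: v12 a_def b_def radial_def angular_def)
    qed
    also have "\<dots> = \<rho> *\<^sub>R radial (c + t)"
      unfolding \<rho>ab[symmetric] by (simp add: radial_def angular_def cos_add sin_add algebra_simps)
    finally have v_eq: "v = \<rho> *\<^sub>R radial (c + t)" .
    moreover have "(norm (radial (c + t)))\<^sup>2 = 1"
      by (simp add: radial_def norm_Pair)
    ultimately show ?thesis
      using homogeneous[of \<rho> "radial (c + t)"] radial_const[OF t] \<rho> by (simp add: power_mult_distrib)
  qed
  ultimately show ?thesis by blast
qed

section \<open>Rotations of the plane\<close>

definition clockwise :: "real \<times> real \<Rightarrow> real \<times> real" where
  "clockwise v = (snd v, - fst v)"

lemma linear_clockwise: "linear clockwise"
  by (simp add: linear_iff clockwise_def)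

text \<open>Separates the angle from the vector: smoothness and derivatives in the angle come from
  \<open>cos\<close> and \<open>sin\<close> alone.\<close>

lemma rotation_eq: "rotation \<theta> v = cos \<theta> *\<^sub>R v + sin \<theta> *\<^sub>R (- clockwise v)"
  by (cases v) (simp add: rotation_def clockwise_def)

lemma linear_rotation: "linear (rotation \<theta>)"
  by (simp add: linear_iff rotation_def algebra_simps split: prod.splits)

lemma rotation_inverse: "rotation \<theta> (rotation (- \<theta>) v) = v"
proof -
  obtain a b where v: "v = (a, b)" by fastforce
  have "cos \<theta> * cos \<theta> + sin \<theta> * sin \<theta> = 1" by simp
  then have "cos \<theta> * (cos \<theta> * a + sin \<theta> * b) - sin \<theta> * (- sin \<theta> * a + cos \<theta> * b) = a"
    "sin \<theta> * (cos \<theta> * a + sin \<theta> * b) + cos \<theta> * (- sin \<theta> * a + cos \<theta> * b) = b"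
    by algebra+
  then show ?thesis by (simp add: v rotation_def)
qed

lemma inj_rotation: "inj (rotation \<theta>)"
  using rotation_inverse[of "- \<theta>"] by (metis injI minus_minus)

subsection \<open>The rotated metric\<close>

lemma banach_minkowski_norm_nonneg: "banach_minkowski_norm \<Phi> \<Longrightarrow> \<Phi> v \<ge> 0"
  unfolding banach_minkowski_norm_def asym_norm_def by blast

lemma banach_minkowski_normD:
  assumes "banach_minkowski_norm \<Phi>"
  shows "minkowski_square (\<lambda>v. (\<Phi> v)\<^sup>2)"
proof
  show "Cn_on 2 (UNIV - {0}) (\<lambda>v. (\<Phi> v)\<^sup>2)"
    using assms by (simp add: banach_minkowski_norm_def smooth_on_def power2_eq_square[of "\<Phi> _"]
        Cn_on_mult open_delete)
qed (use assms in \<open>auto simp: banach_minkowski_norm_def asym_norm_def power_mult_distrib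
      quadratically_strictly_convex_def dest!: spec\<close>)

lemma (in minkowski_square) second_differential_linear_compose:
  fixes T :: "'b::euclidean_space \<Rightarrow> 'a"
  assumes T: "linear T" "inj T" and v: "v \<noteq> 0"
  shows "second_differential (\<lambda>v. F (T v)) v w u = second_differential F (T v) (T w) (T u)"
proof -
  have T0: "T z \<noteq> 0" if "z \<noteq> 0" for z
    using T that linear_injective_0 by blast
  have dT: "(T has_derivative T) (at z)" for z
    using T(1) by (rule linear_imp_has_derivative)
  have "((\<lambda>v. F (T v)) has_derivative (\<lambda>h. D (T z) (T h))) (at z)" if "z \<noteq> 0" for z
    using has_derivative_compose[OF dT has_derivative[OF T0[OF that]]] .
  from fun_cong[OF frechet_derivative_at[OF this]]
  have fd: "D (T z) (T w) = frechet_derivative (\<lambda>v. F (T v)) (at z) w" if "z \<in> UNIV - {0}" for z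
    using that by simp
  have "((\<lambda>z. D (T z) (T w)) has_derivative
      (\<lambda>u. D (T v) 0 + second_differential F (T v) (T w) (T u))) (at v)"
    by (rule has_derivative_D[OF T0[OF v] dT has_derivative_const])
  from has_derivative_transform_within_open[OF this _ _ fd, of "UNIV - {0}"] v
  have "((\<lambda>z. frechet_derivative (\<lambda>v. F (T v)) (at z) w) has_derivative
      (\<lambda>u. D (T v) 0 + second_differential F (T v) (T w) (T u))) (at v)"
    by (simp add: open_delete)
  from fun_cong[OF frechet_derivative_at[OF this], of u]
  show ?thesis
    using linear_0[OF linear_D[OF T0[OF v]]] by (simp add: second_differential_def)
qed

lemma banach_minkowski_norm_linear:
  fixes \<Phi> :: "'b::euclidean_space \<Rightarrow> real" and T :: "'a::euclidean_space \<Rightarrow> 'b"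
  assumes \<Phi>: "banach_minkowski_norm \<Phi>" and T: "linear T" "inj T"
  shows "banach_minkowski_norm (\<lambda>v. \<Phi> (T v))"
proof -
  note sq = banach_minkowski_normD[OF \<Phi>]
  have T0: "T v \<noteq> 0" if "v \<noteq> 0" for v
    using T that linear_injective_0 by blast
  have op: "open (UNIV - {0::'a})" "open (UNIV - {0::'b})" by (simp_all add: open_delete)
  have "asym_norm (\<lambda>v. \<Phi> (T v))"
    using \<Phi> T0 unfolding banach_minkowski_norm_def asym_norm_def
    by (simp add: linear_add[OF T(1)] linear_scale[OF T(1)])
  moreover have "smooth_on (UNIV - {0}) (\<lambda>v. \<Phi> (T v))"
    unfolding smooth_on_def
  proof
    fix n
    show "Cn_on n (UNIV - {0}) (\<lambda>v. \<Phi> (T v))"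
    proof (rule Cn_on_compose[OF op _ _ Cn_on_linear[OF _ op(1)]])
      show "T ` (UNIV - {0}) \<subseteq> UNIV - {0}" using T0 by auto
      show "Cn_on n (UNIV - {0}) \<Phi>"
        using \<Phi> by (simp add: banach_minkowski_norm_def smooth_on_def)
      show "bounded_linear T" using T(1) by (simp add: linear_conv_bounded_linear)
    qed
  qed
  moreover have "second_differential (\<lambda>v. (\<Phi> (T v))\<^sup>2) v w w > 0" if "v \<noteq> 0" "w \<noteq> 0" for v w
    using minkowski_square.second_differential_linear_compose[OF sq T that(1), of w w]
      minkowski_square.convex[OF sq T0[OF that(1)] T0[OF that(2)]] by simp
  ultimately show ?thesis
    by (simp add: banach_minkowski_norm_def quadratically_strictly_convex_def)
qed

text \<open>Smoothness settles all points but 0; there the bound by \<open>norm v * M\<close>, with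
  \<open>M\<close> a bound on the unit sphere, gives the limit.\<close>

lemma banach_minkowski_norm_continuous:
  fixes \<Phi> :: "'a::euclidean_space \<Rightarrow> real"
  assumes \<Phi>: "banach_minkowski_norm \<Phi>"
  shows "continuous_on UNIV \<Phi>"
proof -
  have "Cn_on 0 (UNIV - {0}) \<Phi>"
    using \<Phi> unfolding banach_minkowski_norm_def smooth_on_def by blast
  then have c: "continuous_on (UNIV - {0}) \<Phi>" by simp
  have scale: "\<Phi> (t *\<^sub>R v) = t * \<Phi> v" if "t \<ge> 0" for t v
    using \<Phi> that by (simp add: banach_minkowski_norm_def asym_norm_def)
  note nonneg = banach_minkowski_norm_nonneg[OF \<Phi>]
  have "compact (\<Phi> ` sphere 0 1)"
    by (intro compact_continuous_image continuous_on_subset[OF c]) auto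
  then obtain M where M: "\<And>v. v \<in> sphere 0 1 \<Longrightarrow> \<Phi> v \<le> M"
    using compact_imp_bounded bounded_real by (metis abs_le_D1 imageI)
  have zero: "\<Phi> 0 = 0" using scale[of 0 0] by simp
  have bound: "norm (\<Phi> v) \<le> norm v * M" for v
  proof (cases "v = 0")
    case False
    then have "\<Phi> ((1 / norm v) *\<^sub>R v) \<le> M" by (intro M) simp
    then show ?thesis using False scale[of "1 / norm v" v] nonneg[of v]
      by (simp add: field_simps)
  qed (simp add: zero)
  have "isCont \<Phi> v" for v
  proof (cases "v = 0")
    case True
    have "(\<Phi> \<longlongrightarrow> 0) (at 0)"
    proof (rule Lim_null_comparison)
      show "\<forall>\<^sub>F v in at 0. norm (\<Phi> v) \<le> norm v * M" using bound by simp
      have "((\<lambda>v::'a. norm v * M) \<longlongrightarrow> norm (0::'a) * M) (at 0)" by (intro tendsto_intros)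
      then show "((\<lambda>v::'a. norm v * M) \<longlongrightarrow> 0) (at 0)" by simp
    qed
    then show ?thesis using True zero by (simp add: isCont_def)
  next
    case False
    then show ?thesis
      using c continuous_on_eq_continuous_at[of "UNIV - {0}" \<Phi>] by (simp add: open_delete)
  qed
  then show ?thesis by (simp add: continuous_at_imp_continuous_on)
qed

lemma Cn_on_cos_sin_snd:
  fixes S :: "('a::euclidean_space \<times> real) set"
  assumes "open S"
  shows "Cn_on n S (\<lambda>p. cos (snd p))" "Cn_on n S (\<lambda>p. sin (snd p))"
  by (rule Cn_on_compose[OF assms open_UNIV subset_UNIV _ Cn_on_linear[OF bounded_linear_snd assms]],
      rule Cn_on_sin_cos[THEN conjunct2] Cn_on_sin_cos[THEN conjunct1])+

lemma Cn_on_rotation: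
  fixes S :: "((real \<times> real) \<times> (real \<times> real)) set"
  assumes "open S"
  shows "Cn_on n S (\<lambda>z. rotation (snd (fst z)) (snd z))"
proof -
  have cs: "Cn_on n S (\<lambda>z. cos (snd (fst z)))" "Cn_on n S (\<lambda>z. sin (snd (fst z)))"
    by (rule Cn_on_compose[OF assms open_UNIV subset_UNIV _ Cn_on_linear[OF bounded_linear_fst assms]],
        rule Cn_on_cos_sin_snd[OF open_UNIV])+
  have "bounded_linear (\<lambda>z :: (real \<times> real) \<times> (real \<times> real). - clockwise (snd z))"
    using linear_clockwise
    by (intro bounded_linear_minus bounded_linear_compose[OF _ bounded_linear_snd])
      (simp add: linear_conv_bounded_linear)
  note lin = Cn_on_linear[OF bounded_linear_snd assms] Cn_on_linear[OF this assms]
  show ?thesis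
    unfolding rotation_eq
    by (rule Cn_on_add[OF assms Cn_on_scaleR[OF assms cs(1) lin(1)] Cn_on_scaleR[OF assms cs(2) lin(2)]])
qed

lemma rotated_metric_eq: "rotated_metric \<phi> p v = \<phi> (rotation (snd p) v)"
  by (simp add: rotated_metric_def split: prod.splits)

lemma finsler_rotated_metric:
  assumes \<phi>: "banach_minkowski_norm \<phi>"
  shows "finsler_metric_on UNIV (rotated_metric \<phi>)"
  unfolding finsler_metric_on_def
proof (intro conjI ballI)
  let ?R = "\<lambda>z :: (real \<times> real) \<times> (real \<times> real). rotation (snd (fst z)) (snd z)"
  have eq: "(\<lambda>(p, v). rotated_metric \<phi> p v) = (\<lambda>z. \<phi> (?R z))"
    by (simp add: fun_eq_iff rotated_metric_eq)
  have "continuous_on UNIV ?R"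
    using Cn_on_rotation[of UNIV 0] by simp
  from continuous_on_compose2[OF banach_minkowski_norm_continuous[OF \<phi>] this]
  show "continuous_on (UNIV \<times> UNIV) (\<lambda>(p, v). rotated_metric \<phi> p v)"
    unfolding eq by simp
  have op: "open (UNIV \<times> (UNIV - {0}) :: ((real \<times> real) \<times> (real \<times> real)) set)"
    by (intro open_Times open_delete open_UNIV)
  have nz: "?R ` (UNIV \<times> (UNIV - {0})) \<subseteq> UNIV - {0}"
    using linear_rotation inj_rotation linear_injective_0 by fastforce
  show "smooth_on (UNIV \<times> (UNIV - {0})) (\<lambda>(p, v). rotated_metric \<phi> p v)"
    unfolding eq smooth_on_def
  proof
    fix n
    show "Cn_on n (UNIV \<times> (UNIV - {0})) (\<lambda>z. \<phi> (?R z))"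
      by (rule Cn_on_compose[OF op _ nz _ Cn_on_rotation[OF op]])
        (use \<phi> in \<open>simp_all add: banach_minkowski_norm_def smooth_on_def open_delete\<close>)
  qed
  show "banach_minkowski_norm (rotated_metric \<phi> p)" for p
    unfolding rotated_metric_eq
    using banach_minkowski_norm_linear[OF \<phi> linear_rotation inj_rotation, of "snd p"] by simp
qed

section \<open>From isometric embeddings to rotating frames\<close>

lemma planar_minkowski_square_of_norm:
  assumes \<phi>: "banach_minkowski_norm \<phi>" and ne: "\<not> euclidean_norm \<phi>"
  shows "planar_minkowski_square (\<lambda>v. (\<phi> v)\<^sup>2)"
proof -
  have "\<phi> v = sqrt ((\<phi> v)\<^sup>2)" for v
    using banach_minkowski_norm_nonneg[OF \<phi>, of v] by simp
  then show ?thesis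
    using ne banach_minkowski_normD[OF \<phi>] unfolding euclidean_norm_def
    by (intro planar_minkowski_square.intro planar_minkowski_square_axioms.intro) metis+
qed

text \<open>Undoing the rotation before applying the differential of \<open>f\<close> turns the
  varying norms on the tangent spaces into the fixed norm \<open>\<phi>\<close>, so the results on
  rotating frames apply.\<close>

lemma isometric_embedding_D_radial_angular:
  fixes \<Phi> :: "'v::euclidean_space \<Rightarrow> real"
  assumes \<phi>: "banach_minkowski_norm \<phi>" "\<not> euclidean_norm \<phi>" and dim: "DIM('v) = 3"
    and U: "open U" and \<Phi>: "banach_minkowski_norm \<Phi>"
    and iso: "isometric_embedding_on U (rotated_metric \<phi>) \<Phi> f" and p: "p \<in> U"
  shows "frechet_derivative (\<lambda>v. (\<phi> v)\<^sup>2) (at (radial (snd p))) (angular (snd p)) = 0"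
proof -
  define df where "df p u = frechet_derivative f (at p) u" for p u
  define ddf where "ddf h p u = frechet_derivative (\<lambda>q. df q u) (at p) h" for h p u
  have C: "Cn_on n U f" for n
    using iso by (simp add: isometric_embedding_on_def smooth_embedding_on_def smooth_on_def)
  have Cdf: "Cn_on n U (\<lambda>q. df q u)" for n u
    using C[of "Suc n", unfolded Cn_on.simps] unfolding df_def by blast
  have lin_df: "linear (df q)" if "q \<in> U" for q
    using has_derivative_linear[OF Cn_on_2_D(1)[OF C that]] by (simp add: df_def[abs_def])
  have ddf: "((\<lambda>q. df q u) has_derivative (\<lambda>h. ddf h q u)) (at q)" if "q \<in> U" for q u
    using Cn_on_2_D(1)[OF Cdf that] by (simp add: ddf_def)
  have lin_ddf: "linear (ddf h q)" if "q \<in> U" for h q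
    unfolding ddf_def
    by (rule linear_frechet_derivative_family[OF U that lin_df])
      (use ddf[OF that] differentiable_def in blast)+
  have commute: "ddf h q u = ddf u q h" if "q \<in> U" for h q u
    unfolding ddf_def df_def by (rule mixed_derivative_commute[OF U that C])
  \<comment> \<open>The expansion of \<open>df q (rotation (- snd q) u)\<close>, chosen so that
    \<open>q\<close> enters only through scalar coefficients and \<open>df\<close> at fixed
    vectors.\<close>
  define E where "E q u = cos (snd q) *\<^sub>R df q u + sin (snd q) *\<^sub>R df q (clockwise u)" for q u
  have E_eq: "E q u = df q (rotation (- snd q) u)" if "q \<in> U" for q u
    by (simp add: E_def rotation_eq linear_add[OF lin_df[OF that]] linear_diff[OF lin_df[OF that]]
        linear_scale[OF lin_df[OF that]] linear_neg[OF lin_df[OF that]])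
  have S: "framed_surface (\<lambda>v. (\<Phi> v)\<^sup>2) (\<lambda>v. (\<phi> v)\<^sup>2) U E"
  proof (intro framed_surface.intro framed_surface_axioms.intro)
    show "minkowski_square (\<lambda>v. (\<Phi> v)\<^sup>2)" by (rule banach_minkowski_normD[OF \<Phi>])
    show "planar_minkowski_square (\<lambda>v. (\<phi> v)\<^sup>2)" by (rule planar_minkowski_square_of_norm[OF \<phi>])
    show "linear (E q)" if "q \<in> U" for q
    proof -
      have "E q = df q \<circ> rotation (- snd q)"
        using E_eq[OF that] by (simp add: fun_eq_iff)
      then show ?thesis using linear_compose[OF linear_rotation lin_df[OF that]] by simp
    qed
    show "Cn_on 2 U (\<lambda>q. E q u)" for u
      unfolding E_def by (intro Cn_on_add Cn_on_scaleR Cn_on_cos_sin_snd Cdf U)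
    show "(\<Phi> (E q u))\<^sup>2 = (\<phi> u)\<^sup>2" if "q \<in> U" for q u
    proof -
      have "\<Phi> (df q v) = rotated_metric \<phi> q v" for v
        using iso that unfolding isometric_embedding_on_def df_def by blast
      then show ?thesis
        unfolding E_eq[OF that] by (simp add: rotated_metric_eq rotation_inverse)
    qed
  qed (use U dim in auto)
  have E1: "framed_surface.E1 E h q u = cos (snd q) *\<^sub>R ddf h q u + sin (snd q) *\<^sub>R ddf h q (clockwise u)
      + snd h *\<^sub>R (cos (snd q) *\<^sub>R df q (clockwise u) - sin (snd q) *\<^sub>R df q u)"
    if q: "q \<in> U" for h q u
  proof -
    have s: "(snd has_derivative snd) (at q)"
      by (rule bounded_linear_imp_has_derivative[OF bounded_linear_snd])
    have "((\<lambda>q. E q u) has_derivative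
      (\<lambda>h. (cos (snd q) *\<^sub>R ddf h q u + (snd h * - sin (snd q)) *\<^sub>R df q u)
        + (sin (snd q) *\<^sub>R ddf h q (clockwise u) + (snd h * cos (snd q)) *\<^sub>R df q (clockwise u)))) (at q)"
      unfolding E_def
      by (rule has_derivative_add[OF has_derivative_scaleR[OF has_derivative_cos[OF s] ddf[OF q]]
            has_derivative_scaleR[OF has_derivative_sin[OF s] ddf[OF q]]])
    from fun_cong[OF has_derivative_unique[OF framed_surface.has_derivative_E[OF S q] this], of h]
    show ?thesis by (simp add: algebra_simps)
  qed
  have "rotating_frame (\<lambda>v. (\<Phi> v)\<^sup>2) (\<lambda>v. (\<phi> v)\<^sup>2) U E"
  proof (intro rotating_frame.intro[OF S] rotating_frame_axioms.intro)
    fix q assume q: "q \<in> U"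
    define r a where "r = radial (snd q)" and "a = angular (snd q)"
    have cw: "clockwise r = - a" "clockwise a = r"
      by (simp_all add: r_def a_def clockwise_def radial_def angular_def)
    have basis: "cos (snd q) *\<^sub>R r - sin (snd q) *\<^sub>R a = (1, 0)" "cos (snd q) *\<^sub>R a + sin (snd q) *\<^sub>R r = (0, 1)"
      by (simp_all add: r_def a_def radial_def angular_def)
    note lin = linear_add[OF lin_df[OF q]] linear_diff[OF lin_df[OF q]] linear_scale[OF lin_df[OF q]]
      linear_neg[OF lin_df[OF q]] linear_add[OF lin_ddf[OF q]] linear_diff[OF lin_ddf[OF q]]
      linear_scale[OF lin_ddf[OF q]] linear_neg[OF lin_ddf[OF q]]
    \<comment> \<open>The derivatives of \<open>cos\<close> and \<open>sin\<close> contribute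
      exactly \<open>- E q a\<close>, and rotating back turns \<open>r\<close> and \<open>a\<close>
      into the coordinate vectors, so only symmetry of \<open>ddf\<close> remains.\<close>
    have "framed_surface.E1 E (0, 1) q r + E q a = ddf (0, 1) q (cos (snd q) *\<^sub>R r - sin (snd q) *\<^sub>R a)"
      by (simp add: E1[OF q] E_def cw lin)
    also have "\<dots> = ddf (1, 0) q (cos (snd q) *\<^sub>R a + sin (snd q) *\<^sub>R r)"
      unfolding basis by (rule commute[OF q])
    also have "\<dots> = framed_surface.E1 E (1, 0) q a"
      by (simp add: E1[OF q] cw lin)
    finally show "framed_surface.E1 E (0, 1) q (radial (snd q)) + E q (angular (snd q)) = framed_surface.E1 E (1, 0) q (angular (snd q))"
      by (simp add: r_def a_def)
  qed
  then show ?thesis by (rule rotating_frame.D_radial_angular[OF _ p])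
qed

theorem proposition5p2:
  fixes \<phi>\<^sub>0 :: "real \<times> real \<Rightarrow> real"
  assumes "banach_minkowski_norm \<phi>\<^sub>0"
    and "\<not> euclidean_norm \<phi>\<^sub>0"
    and "\<not> (\<exists>W \<Psi>. open W \<and> W \<noteq> {} \<and> euclidean_norm \<Psi> \<and> (\<forall>v\<in>W. \<phi>\<^sub>0 v = \<Psi> v))"
    and "DIM('v::euclidean_space) = 3"
  shows "finsler_metric_on UNIV (rotated_metric \<phi>\<^sub>0) \<and>
    (\<forall>U. open U \<and> U \<noteq> {} \<longrightarrow>
      \<not> (\<exists>(\<Phi> :: 'v \<Rightarrow> real) f.
            banach_minkowski_norm \<Phi> \<and>
            isometric_embedding_on U (rotated_metric \<phi>\<^sub>0) \<Phi> f))"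
proof (intro conjI allI impI notI finsler_rotated_metric assms(1); elim conjE exE)
  fix U :: "(real \<times> real) set" and \<Phi> :: "'v \<Rightarrow> real" and f
  assume U: "open U" "U \<noteq> {}" and \<Phi>: "banach_minkowski_norm \<Phi>"
    and iso: "isometric_embedding_on U (rotated_metric \<phi>\<^sub>0) \<Phi> f"
  obtain x c where xc: "(x, c) \<in> U" using U(2) by auto
  obtain \<epsilon> where \<epsilon>: "\<epsilon> > 0" "ball (x, c) \<epsilon> \<subseteq> U"
    using U(1) xc open_contains_ball by blast
  have "frechet_derivative (\<lambda>v. (\<phi>\<^sub>0 v)\<^sup>2) (at (radial y)) (angular y) = 0" if "\<bar>y - c\<bar> < \<epsilon>" for y
  proof -
    \<comment> \<open>Only the second coordinate is varied, so \<open>radial y\<close> sweeps out an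
      arc.\<close>
    have "(x, y) \<in> ball (x, c) \<epsilon>"
      using that by (simp add: dist_Pair_Pair dist_real_def abs_minus_commute)
    then have "(x, y) \<in> U" using \<epsilon>(2) by blast
    from isometric_embedding_D_radial_angular[OF assms(1,2,4) U(1) \<Phi> iso this]
    show ?thesis by simp
  qed
  then have "\<exists>W C. open W \<and> W \<noteq> {} \<and> C > 0 \<and> (\<forall>v\<in>W. (\<phi>\<^sub>0 v)\<^sup>2 = C * (norm v)\<^sup>2)"
    by (rule planar_minkowski_square.eq_norm_square_on_sector[
          OF planar_minkowski_square_of_norm[OF assms(1,2)] \<epsilon>(1)])
  then obtain W C where W: "open W" "W \<noteq> {}" "C > 0" "\<forall>v\<in>W. (\<phi>\<^sub>0 v)\<^sup>2 = C * (norm v)\<^sup>2"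
    by (elim exE conjE)
  \<comment> \<open>The norm of this multiple of the standard inner product agrees with
    \<open>\<phi>\<^sub>0\<close> on \<open>W\<close>, which the third assumption forbids.\<close>
  define B where "B v w = C * (v \<bullet> w)" for v w :: "real \<times> real"
  have "inner_product B"
    unfolding inner_product_def bilinear_def linear_iff
    using W(3) by (auto simp: B_def algebra_simps inner_commute)
  then have "euclidean_norm (\<lambda>v. sqrt (B v v))"
    unfolding euclidean_norm_def by blast
  moreover have "\<phi>\<^sub>0 v = sqrt (B v v)" if "v \<in> W" for v
  proof -
    show ?thesis
      using banach_minkowski_norm_nonneg[OF assms(1), of v] bspec[OF W(4) that] by (simp add: B_def power2_norm_eq_inner real_sqrt_unique)
  qed
  ultimately show False
    using assms(3) W(1,2) by blast
qed

end
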